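(* Let $\nu\in\mathbb{N}_0$. The sets $\mathscr{M}_\nu$, $\mathscr{M}_\nu^+$ and $\mathscr{M}_\nu^-$ form orthogonal bases in $\mathscr{L}_2(\mathbb{R},w_\nu)$, $\mathscr{L}_2(\mathbb{R}_+,w_\nu)$ and $\mathscr{L}_2(\mathbb{R}_-,w_\nu)$, respectively. Furthermore, $$\|\psi^{+}_{m,\nu}\|_{\mathscr{L}_2(\mathbb{R},w_\nu)}^2=\|\psi^{-}_{m,\nu}\|_{\mathscr{L}_2(\mathbb{R},w_\nu)}^2=\frac{(\nu!)^2}{(2\nu)!}\frac{m!}{(m+\nu+1)!}\quad\text{for every } m\in\mathbb{N}_0.$$
   Context: $\mathbb{N}_0=\{0,1,2,\ldots\}$; $\mathbb{R}_+$ and $\mathbb{R}_-$ are the positive and negative real half-lines. For $\Omega\subseteq\mathbb{R}$ and a weight function $w$, $\mathscr{L}_2(\Omega,w)$ is the Hilbert space of functions $f:\Omega\to\mathbb{C}$ with finite norm for the inner product $\langle f,g\rangle=\int_\Omega f^*(t)g(t)w(t)\,dt$, where $^*$ is complex conjugation. The weight is $w_\nu(t)=2/|2t|^{\nu+1}$. The associated Laguerre polynomials are $\mathrm{L}_m^{(\eta)}(t)=\sum_{k=0}^m\binom{m+\eta}{m-k}\frac{(-1)^k}{k!}t^k$. For $m\in\mathbb{N}_0$, $$\psi^{+}_{m,\nu}(t)=\frac{\nu!}{\sqrt{(2\nu)!}}\frac{m!}{(m+\nu+1)!}(2t)^{\nu+1}\mathrm{L}_m^{(\nu+1)}(2t)e^{-t}\mathbf{1}_{[0,\infty)}(t),\qquad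 \psi^{-}_{m,\nu}(t)=(-1)^\nu\psi^{+}_{m,\nu}(-t).$$ The sets are $\mathscr{M}_\nu^+=\{\psi^{+}_{m,\nu}\}_{m\in\mathbb{N}_0}$, $\mathscr{M}_\nu^-=\{\psi^{-}_{m,\nu}\}_{m\in\mathbb{N}_0}$ and $\mathscr{M}_\nu=\mathscr{M}_\nu^-\cup\mathscr{M}_\nu^+$ (functions being restricted to the respective half-line where appropriate). *)

theory Defs
  imports "HOL-Analysis.Analysis"
begin

text \<open>
  Elements of the weighted space are represented by total functions on the real line.
  Every notion below integrates against \<open>lebesgue_on \<Omega>\<close>, so values outside \<open>\<Omega>\<close> and on null
  sets are irrelevant, and restriction to \<open>\<Omega>\<close> is implicit.
\<close>

definition L2_inner ::
    "real set \<Rightarrow> (real \<Rightarrow> real) \<Rightarrow> (real \<Rightarrow> complex) \<Rightarrow> (real \<Rightarrow> complex) \<Rightarrow> complex" where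
  "L2_inner \<Omega> w f g = (LINT t|lebesgue_on \<Omega>. cnj (f t) * g t * complex_of_real (w t))"

definition L2_norm :: "real set \<Rightarrow> (real \<Rightarrow> real) \<Rightarrow> (real \<Rightarrow> complex) \<Rightarrow> real" where
  "L2_norm \<Omega> w f = sqrt (Re (L2_inner \<Omega> w f f))"

text \<open>Integrability is explicit because the Bochner integral is \<open>0\<close> on non-integrable functions.\<close>

definition L2_space :: "real set \<Rightarrow> (real \<Rightarrow> real) \<Rightarrow> (real \<Rightarrow> complex) set" where
  "L2_space \<Omega> w = {f \<in> borel_measurable (lebesgue_on \<Omega>).
     integrable (lebesgue_on \<Omega>) (\<lambda>t. (cmod (f t))\<^sup>2 * w t)}"

text \<open>
  An orthogonal basis of the Hilbert space: nonzero, pairwise orthogonal elements whose finite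
  complex linear combinations are dense. Nonzero means nonzero as an equivalence class.
\<close>

definition L2_orthogonal_basis ::
    "real set \<Rightarrow> (real \<Rightarrow> real) \<Rightarrow> (real \<Rightarrow> complex) set \<Rightarrow> bool" where
  "L2_orthogonal_basis \<Omega> w B \<longleftrightarrow>
     B \<subseteq> L2_space \<Omega> w \<and>
     (\<forall>g\<in>B. L2_norm \<Omega> w g \<noteq> 0) \<and>
     pairwise (\<lambda>g h. L2_inner \<Omega> w g h = 0) B \<and>
     (\<forall>f\<in>L2_space \<Omega> w. \<forall>\<epsilon>>0. \<exists>F c. finite F \<and> F \<subseteq> B \<and>
        L2_norm \<Omega> w (\<lambda>t. f t - (\<Sum>g\<in>F. c g * g t)) < \<epsilon>)"

text \<open>At \<open>t = 0\<close> the weight takes the value \<open>0\<close> by the convention on division.\<close>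

definition weight :: "nat \<Rightarrow> real \<Rightarrow> real" where
  "weight \<nu> t = 2 / \<bar>2 * t\<bar> ^ (\<nu> + 1)"

definition laguerre :: "nat \<Rightarrow> real \<Rightarrow> real \<Rightarrow> real" where
  "laguerre m \<eta> t = (\<Sum>k\<le>m. ((real m + \<eta>) gchoose (m - k)) * ((-1) ^ k / fact k) * t ^ k)"

definition psi_plus :: "nat \<Rightarrow> nat \<Rightarrow> real \<Rightarrow> complex" where
  "psi_plus \<nu> m t = complex_of_real
     (fact \<nu> / sqrt (fact (2 * \<nu>)) * (fact m / fact (m + \<nu> + 1))
      * (2 * t) ^ (\<nu> + 1) * laguerre m (real (\<nu> + 1)) (2 * t) * exp (- t)
      * indicator {0..} t)"

definition psi_minus :: "nat \<Rightarrow> nat \<Rightarrow> real \<Rightarrow> complex" where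
  "psi_minus \<nu> m t = (-1) ^ \<nu> * psi_plus \<nu> m (- t)"

definition M_plus :: "nat \<Rightarrow> (real \<Rightarrow> complex) set" where
  "M_plus \<nu> = range (psi_plus \<nu>)"

definition M_minus :: "nat \<Rightarrow> (real \<Rightarrow> complex) set" where
  "M_minus \<nu> = range (psi_minus \<nu>)"

definition M_full :: "nat \<Rightarrow> (real \<Rightarrow> complex) set" where
  "M_full \<nu> = M_minus \<nu> \<union> M_plus \<nu>"

end

theory Submission
  imports Defs "HOL-Probability.Distributions"
begin

text \<open>
  Write \<open>a = \<nu> + 1\<close>. On the positive half-line \<open>\<psi>\<^sup>+\<^sub>m\<close> is a constant times \<open>b(t) L\<^sub>m(2t)\<close> with the
  envelope \<open>b(t) = (2t)\<^sup>a e\<^sup>-\<^sup>t\<close>, and \<open>b\<^sup>2 w\<^sub>\<nu>\<close> is the density \<open>2 (2t)\<^sup>a e\<^sup>-\<^sup>2\<^sup>t\<close>, that is, the classical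
  Laguerre weight in the variable \<open>2t\<close>. Division by \<open>b\<close> therefore turns the claim for the
  positive half-line into the statement that the Laguerre polynomials are a complete orthogonal
  system for the finite measure \<open>\<mu>\<close> with this density (\<open>laguerre_measure\<close>).

  Orthogonality: all integrals needed are integrals of \<open>(2t)\<^sup>j e\<^sup>-\<^sup>2\<^sup>s\<^sup>t\<close> against \<open>\<mu>\<close>, known from the Erlang
  density. The integral of \<open>(2t)\<^sup>j L\<^sub>n(2t)\<close> becomes, up to a factor, an \<open>n\<close>-th finite difference of a polynomial of
  degree \<open>j\<close>, so it vanishes for \<open>j < n\<close> and is explicit for \<open>j = n\<close>.

  Completeness: every function \<open>e\<^sup>-\<^sup>2\<^sup>j\<^sup>t\<close> with \<open>j \<in> \<nat>\<close> lies in the closed span of the Laguerre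
  polynomials. Indeed its Fourier coefficients form, up to explicit factors, a geometric
  sequence, Parseval's identity reduces to the negative binomial series
  (\<open>negative_binomial_sums\<close>), and by Bessel's identity Parseval's identity is the same as
  convergence of the expansion (\<open>L2_approximable_if_parseval\<close>). These exponentials, in turn, are the powers
  of \<open>y = e\<^sup>-\<^sup>2\<^sup>t\<close>, so their span is dense by the Weierstrass theorem on \<open>[0,1]\<close>
  (\<open>L2_approximable_exponentials\<close>).

  The negative half-line follows by reflection, and the whole line because
  its space is the orthogonal sum of the spaces of the two half-lines, the point \<open>0\<close> being
  negligible.
\<close>

section \<open>Finite differences, binomial series and Laguerre coefficients\<close>

lemma sum_choose_Suc:
  fixes h :: "nat \<Rightarrow> real"
  shows "(\<Sum>k\<le>Suc n. real (Suc n choose k) * h k) = (\<Sum>k\<le>n. real (n choose k) * (h k + h (Suc k)))"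
proof -
  have "(\<Sum>k\<le>Suc n. real (Suc n choose k) * h k)
      = h 0 + (\<Sum>k\<le>n. real (n choose k) * h (Suc k) + real (n choose Suc k) * h (Suc k))"
    by (simp only: sum.atMost_Suc_shift) (simp add: algebra_simps)
  moreover have "(\<Sum>k\<le>n. real (n choose Suc k) * h (Suc k)) = (\<Sum>k\<le>Suc n. real (n choose k) * h k) - h 0"
    by (simp only: sum.atMost_Suc_shift) simp
  ultimately show ?thesis
    by (simp add: sum.distrib algebra_simps)
qed

text \<open>
  The left-hand side is, up to sign, the \<open>n\<close>-th finite difference of the polynomial
  \<open>y \<mapsto> pochhammer y j\<close> of degree \<open>j \<le> n\<close>. One difference step lowers the degree by one and turns
  the polynomial into \<open>- j\<close> times a shifted polynomial of the same family, which makes an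
  induction on \<open>n\<close> close up.
\<close>

lemma alternating_sum_pochhammer:
  fixes x :: real
  assumes "j \<le> n"
  shows "(\<Sum>k\<le>n. real (n choose k) * ((-1) ^ k * pochhammer (x + real k) j))
    = (if j = n then (-1) ^ n * fact n else 0)"
  using assms
proof (induction n arbitrary: j x)
  case 0
  then show ?case by simp
next
  case (Suc n)
  have diff: "pochhammer y i - pochhammer (y + 1) i = - real i * pochhammer (y + 1) (i - 1)" for y :: real and i
  proof (cases i)
    case (Suc l)
    have "pochhammer y (Suc l) = y * pochhammer (y + 1) l"
      by (rule pochhammer_rec)
    moreover have "pochhammer (y + 1) (Suc l) = (y + 1 + real l) * pochhammer (y + 1) l"
      by (rule pochhammer_rec')
    ultimately show ?thesis using Suc by (simp add: algebra_simps)
  qed simp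
  have "(\<Sum>k\<le>Suc n. real (Suc n choose k) * ((-1) ^ k * pochhammer (x + real k) j))
      = (\<Sum>k\<le>n. real (n choose k) * ((-1) ^ k * (pochhammer (x + real k) j - pochhammer (x + real k + 1) j)))"
    unfolding sum_choose_Suc by (intro sum.cong) (auto simp: algebra_simps)
  also have "\<dots> = - real j * (\<Sum>k\<le>n. real (n choose k) * ((-1) ^ k * pochhammer ((x + 1) + real k) (j - 1)))"
    unfolding diff sum_distrib_left by (intro sum.cong) (auto simp: algebra_simps)
  also have "\<dots> = (if j = Suc n then (-1) ^ Suc n * fact (Suc n) else 0)"
  proof (cases "j = 0")
    case False
    then have "j - 1 \<le> n" using Suc.prems by simp
    from Suc.IH[OF this, of "x + 1"] False show ?thesis
      by (cases j) (auto simp: algebra_simps)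
  qed simp
  finally show ?case .
qed

text \<open>
  The binomial series with exponent \<open>- (a + 1)\<close>; it evaluates Parseval's sum for exponentials.
\<close>

lemma negative_binomial_sums:
  fixes z :: real
  assumes "\<bar>z\<bar> < 1"
  shows "(\<lambda>n. fact (n + a) / fact n * z ^ n) sums (fact a / (1 - z) ^ (a + 1))"
proof -
  have eq: "(- real (a + 1) gchoose n) * (- z) ^ n = real ((n + a) choose n) * z ^ n" for n
  proof -
    have "(- real (a + 1) gchoose n) = (-1) ^ n * (real (n + a) gchoose n)"
      by (subst gbinomial_minus) (simp add: add_ac)
    then show ?thesis
      by (simp add: binomial_gbinomial power_mult_distrib[symmetric] mult.assoc[symmetric])
  qed
  have "(\<lambda>n. real ((n + a) choose n) * z ^ n) sums (1 + - z) powr (- real (a + 1))"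
    using gen_binomial_real[of "- z" "- real (a + 1)"] assms unfolding eq by simp
  moreover have "(1 + - z) powr (- real (a + 1)) = 1 / (1 - z) ^ (a + 1)"
    using assms by (simp only: powr_minus inverse_eq_divide, subst powr_realpow) auto
  ultimately have "(\<lambda>n. fact a * (real ((n + a) choose n) * z ^ n)) sums (fact a * (1 / (1 - z) ^ (a + 1)))"
    by (intro sums_mult) simp
  moreover have "fact a * real ((n + a) choose n) = fact (n + a) / fact n" for n
    by (subst binomial_fact) auto
  ultimately show ?thesis
    by (simp add: mult.assoc[symmetric])
qed

text \<open>
  For a natural number parameter \<open>a\<close> the generalized binomial coefficient is an ordinary one, so that
  factorials cancel against the moments of the Laguerre weight.
\<close>

definition laguerre_coeff :: "nat \<Rightarrow> nat \<Rightarrow> nat \<Rightarrow> real" where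
  "laguerre_coeff n a k = real ((n + a) choose (n - k)) * ((-1) ^ k / fact k)"

lemma laguerre_eq: "laguerre n (real a) x = (\<Sum>k\<le>n. laguerre_coeff n a k * x ^ k)"
  unfolding laguerre_def laguerre_coeff_def
  by (simp add: binomial_gbinomial)

text \<open>
  The factor \<open>fact (k + a)\<close> is the \<open>k\<close>-th moment of the Laguerre weight. Absorbing it leaves signed
  binomial coefficients of order \<open>n\<close>, so that sums over \<open>k\<close> become binomial expansions or finite
  differences.
\<close>

lemma laguerre_coeff_fact:
  assumes "k \<le> n"
  shows "laguerre_coeff n a k * fact (k + a) = fact (n + a) / fact n * (real (n choose k) * (-1) ^ k)"
proof -
  have "real ((n + a) choose (n - k)) = fact (n + a) / (fact (n - k) * fact (k + a))"
    using assms by (subst binomial_fact) (auto simp: add.commute)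
  moreover have "real (n choose k) = fact n / (fact k * fact (n - k))"
    using assms by (simp add: binomial_fact)
  ultimately show ?thesis
    by (simp add: laguerre_coeff_def)
qed

section \<open>Integrals against the Laguerre weight\<close>

definition laguerre_measure :: "nat \<Rightarrow> real measure" where
  "laguerre_measure a = density (lebesgue_on {0<..}) (\<lambda>t. ennreal (2 * (2 * t) ^ a * exp (- 2 * t)))"

lemma measurable_lebesgue_on_borel: "f \<in> borel_measurable borel \<Longrightarrow> f \<in> borel_measurable (lebesgue_on S)"
  by (simp add: measurable_completion measurable_restrict_space1)

text \<open>
  After normalization the integrand, multiplied by the density of the measure, is the Erlang
  density of shape \<open>j + a\<close> and rate \<open>2 (1 + s)\<close>, which has total mass 1.
\<close>

lemma has_bochner_integral_laguerre_measure:
  assumes "0 \<le> s"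
  shows "has_bochner_integral (laguerre_measure a) (\<lambda>t. (2 * t) ^ j * exp (- (2 * s * t)))
    (fact (j + a) / (1 + s) ^ (j + a + 1))"
proof -
  let ?l = "2 * (1 + s)" and ?k = "j + a"
  have "has_bochner_integral lborel (erlang_density ?k ?l) 1"
    using assms nn_integral_erlang_ith_moment[of ?l ?k 0]
    by (intro has_bochner_integral_nn_integral) auto
  then have "has_bochner_integral lebesgue (erlang_density ?k ?l) 1"
    by (simp add: has_bochner_integral_iff integrable_completion integral_completion)
  then have "has_bochner_integral lebesgue (\<lambda>t. fact ?k / (1 + s) ^ (?k + 1) * erlang_density ?k ?l t)
     (fact ?k / (1 + s) ^ (?k + 1) * 1)"
    by (rule has_bochner_integral_mult_right)
  moreover have "AE t in lebesgue. t \<noteq> 0"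
    by (rule AE_I[of _ _ "{0}"]) auto
  then have "AE t in lebesgue. fact ?k / (1 + s) ^ (?k + 1) * erlang_density ?k ?l t
      = indicator {0<..} t *\<^sub>R ((2 * (2 * t) ^ a * exp (- 2 * t)) *\<^sub>R ((2 * t) ^ j * exp (- (2 * s * t))))"
  proof eventually_elim
    fix t :: real assume "t \<noteq> 0"
    have pow: "?l ^ Suc ?k = 2 * 2 ^ a * 2 ^ j * (1 + s) ^ (?k + 1)"
      unfolding power_mult_distrib by (simp add: power_add)
    have ex: "exp (- ?l * t) = exp (- 2 * t) * exp (- (2 * s * t))"
      by (simp add: exp_add[symmetric] algebra_simps)
    have "fact ?k / (1 + s) ^ (?k + 1) * erlang_density ?k ?l t
        = 2 * 2 ^ a * 2 ^ j * t ^ ?k * exp (- ?l * t)" if "t > 0"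
      unfolding erlang_density_def pow using assms that by simp
    then show "fact ?k / (1 + s) ^ (?k + 1) * erlang_density ?k ?l t
      = indicator {0<..} t *\<^sub>R ((2 * (2 * t) ^ a * exp (- 2 * t)) *\<^sub>R ((2 * t) ^ j * exp (- (2 * s * t))))"
      using \<open>t \<noteq> 0\<close> unfolding ex
      by (auto simp: erlang_density_def indicator_def power_add power_mult_distrib)
  qed
  ultimately have "has_bochner_integral lebesgue
     (\<lambda>t. indicator {0<..} t *\<^sub>R ((2 * (2 * t) ^ a * exp (- 2 * t)) *\<^sub>R ((2 * t) ^ j * exp (- (2 * s * t)))))
     (fact ?k / (1 + s) ^ (?k + 1))"
    by (subst (asm) has_bochner_integral_cong_AE) (auto intro!: borel_measurable_scaleR borel_measurable_indicator measurable_completion)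
  then have "has_bochner_integral (lebesgue_on {0<..})
     (\<lambda>t. (2 * (2 * t) ^ a * exp (- 2 * t)) *\<^sub>R ((2 * t) ^ j * exp (- (2 * s * t))))
     (fact ?k / (1 + s) ^ (?k + 1))"
    by (subst has_bochner_integral_restrict_space) auto
  then show ?thesis
    unfolding laguerre_measure_def
    by (intro has_bochner_integral_density) (auto intro!: AE_I2 measurable_lebesgue_on_borel)
qed

lemma has_bochner_integral_laguerre:
  assumes "0 \<le> s"
  shows "has_bochner_integral (laguerre_measure a)
    (\<lambda>t. (2 * t) ^ j * exp (- (2 * s * t)) * laguerre n (real a) (2 * t))
    (\<Sum>k\<le>n. laguerre_coeff n a k * (fact (k + j + a) / (1 + s) ^ (k + j + a + 1)))"
proof -
  have "has_bochner_integral (laguerre_measure a)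
    (\<lambda>t. \<Sum>k\<le>n. laguerre_coeff n a k * ((2 * t) ^ (k + j) * exp (- (2 * s * t))))
    (\<Sum>k\<le>n. laguerre_coeff n a k * (fact (k + j + a) / (1 + s) ^ (k + j + a + 1)))"
    by (intro has_bochner_integral_sum has_bochner_integral_mult_right
        has_bochner_integral_laguerre_measure assms)
  then show ?thesis
    by (simp add: laguerre_eq sum_distrib_left power_add mult_ac)
qed

text \<open>
  The quotient \<open>fact (k + j + a) / fact (k + a)\<close> is a Pochhammer symbol, a polynomial of degree \<open>j\<close>
  in \<open>k\<close>, and the integral is, up to a factor, its \<open>n\<close>-th finite difference.
\<close>

lemma has_bochner_integral_monomial_laguerre:
  assumes "j \<le> n"
  shows "has_bochner_integral (laguerre_measure a) (\<lambda>t. (2 * t) ^ j * laguerre n (real a) (2 * t))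
    (if j = n then (-1) ^ n * fact (n + a) else 0)"
proof -
  have "laguerre_coeff n a k * fact (k + j + a)
      = fact (n + a) / fact n * (real (n choose k) * ((-1) ^ k * pochhammer (real (a + 1) + real k) j))"
    if "k \<le> n" for k
  proof -
    have "fact (k + j + a) = fact (k + a) * pochhammer (real (a + 1) + real k) j"
      using pochhammer_product'[of "1::real" "k + a" j] by (simp add: pochhammer_fact add_ac)
    then have "laguerre_coeff n a k * fact (k + j + a)
        = (laguerre_coeff n a k * fact (k + a)) * pochhammer (real (a + 1) + real k) j"
      by simp
    then show ?thesis
      by (simp add: laguerre_coeff_fact[OF that] del: of_nat_add)
  qed
  then have "(\<Sum>k\<le>n. laguerre_coeff n a k * fact (k + j + a))
      = fact (n + a) / fact n * (\<Sum>k\<le>n. real (n choose k) * ((-1) ^ k * pochhammer (real (a + 1) + real k) j))"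
    by (simp add: sum_distrib_left)
  also have "\<dots> = (if j = n then (-1) ^ n * fact (n + a) else 0)"
    by (simp add: alternating_sum_pochhammer[OF assms])
  finally show ?thesis
    using has_bochner_integral_laguerre[of 0 a j n] by simp
qed

lemma has_bochner_integral_laguerre_laguerre_le:
  assumes "m \<le> n"
  shows "has_bochner_integral (laguerre_measure a)
    (\<lambda>t. laguerre m (real a) (2 * t) * laguerre n (real a) (2 * t))
    (if m = n then fact (n + a) / fact n else 0)"
proof -
  have "has_bochner_integral (laguerre_measure a)
    (\<lambda>t. \<Sum>j\<le>m. laguerre_coeff m a j * ((2 * t) ^ j * laguerre n (real a) (2 * t)))
    (\<Sum>j\<le>m. laguerre_coeff m a j * (if j = n then (-1) ^ n * fact (n + a) else 0))"
    by (intro has_bochner_integral_sum has_bochner_integral_mult_right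
        has_bochner_integral_monomial_laguerre) (use assms in auto)
  moreover have "(\<Sum>j\<le>m. laguerre_coeff m a j * (if j = n then (-1) ^ n * fact (n + a) else 0))
      = (if m = n then fact (n + a) / fact n else 0)"
    using assms by (auto simp: laguerre_coeff_def if_distrib[of "(*) _"] sum.delta power_mult_distrib[symmetric] cong: if_cong)
  ultimately show ?thesis
    by (simp only: laguerre_eq[of m] sum_distrib_right mult.assoc)
qed

lemma has_bochner_integral_laguerre_laguerre:
  "has_bochner_integral (laguerre_measure a)
    (\<lambda>t. laguerre m (real a) (2 * t) * laguerre n (real a) (2 * t))
    (if m = n then fact (n + a) / fact n else 0)"
proof (cases "m \<le> n")
  case False
  then show ?thesis
    using has_bochner_integral_laguerre_laguerre_le[of n m a] by (simp add: mult.commute)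
qed (rule has_bochner_integral_laguerre_laguerre_le)

text \<open>
  Here the sum over \<open>k\<close> is the binomial expansion of \<open>(1 - 1 / (1 + s)) ^ n\<close>. The result is
  geometric in \<open>n\<close>, which is what makes Parseval's identity for exponentials summable in closed
  form.
\<close>

lemma has_bochner_integral_exp_laguerre:
  assumes "0 \<le> s"
  shows "has_bochner_integral (laguerre_measure a)
    (\<lambda>t. exp (- (2 * s * t)) * laguerre n (real a) (2 * t))
    (fact (n + a) / fact n * (s / (1 + s)) ^ n / (1 + s) ^ (a + 1))"
proof -
  have "(\<Sum>k\<le>n. laguerre_coeff n a k * (fact (k + a) / (1 + s) ^ (k + a + 1)))
      = (\<Sum>k\<le>n. fact (n + a) / fact n / (1 + s) ^ (a + 1) * (real (n choose k) * (- 1 / (1 + s)) ^ k * 1 ^ (n - k)))"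
  proof (intro sum.cong refl)
    fix k assume "k \<in> {..n}"
    have "laguerre_coeff n a k * (fact (k + a) / (1 + s) ^ (k + a + 1))
        = (laguerre_coeff n a k * fact (k + a)) / ((1 + s) ^ (a + 1) * (1 + s) ^ k)"
      by (simp add: power_add)
    also have "\<dots> = fact (n + a) / fact n / (1 + s) ^ (a + 1) * (real (n choose k) * ((-1) ^ k / (1 + s) ^ k))"
      using laguerre_coeff_fact[of k n a] \<open>k \<in> {..n}\<close> by simp
    finally show "laguerre_coeff n a k * (fact (k + a) / (1 + s) ^ (k + a + 1))
      = fact (n + a) / fact n / (1 + s) ^ (a + 1) * (real (n choose k) * (- 1 / (1 + s)) ^ k * 1 ^ (n - k))"
      unfolding power_divide by simp
  qed
  also have "\<dots> = fact (n + a) / fact n / (1 + s) ^ (a + 1) * (- 1 / (1 + s) + 1) ^ n"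
    unfolding binomial_ring sum_distrib_left ..
  also have "- 1 / (1 + s) + 1 = s / (1 + s)"
    using assms by (simp add: field_simps)
  finally show ?thesis
    using has_bochner_integral_laguerre[OF assms, of a 0 n] by simp
qed

section \<open>Approximation in the mean square\<close>

definition square_integrable :: "'a measure \<Rightarrow> ('a \<Rightarrow> real) \<Rightarrow> bool" where
  "square_integrable M f \<longleftrightarrow> f \<in> borel_measurable M \<and> integrable M (\<lambda>x. (f x)\<^sup>2)"

text \<open>
  Membership in the closed linear span of the sequence \<open>\<phi>\<close>, in the real space
  \<open>L\<^sup>2(M)\<close>.
\<close>

definition L2_approximable :: "'a measure \<Rightarrow> (nat \<Rightarrow> 'a \<Rightarrow> real) \<Rightarrow> ('a \<Rightarrow> real) \<Rightarrow> bool" where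
  "L2_approximable M \<phi> f \<longleftrightarrow>
     (\<forall>\<epsilon>>0. \<exists>d N. (LINT x|M. (f x - (\<Sum>n<N. d n * \<phi> n x))\<^sup>2) < \<epsilon>)"

lemma sum_squared_le: "(a + b)\<^sup>2 \<le> 2 * a\<^sup>2 + 2 * (b::real)\<^sup>2"
  using zero_le_power2[of "a - b"] by (simp add: power2_eq_square algebra_simps)

lemma square_integrable_mult:
  assumes "square_integrable M f" "square_integrable M g"
  shows "integrable M (\<lambda>x. f x * g x)"
proof (rule Bochner_Integration.integrable_bound)
  show "integrable M (\<lambda>x. (f x)\<^sup>2 + (g x)\<^sup>2)"
    using assms unfolding square_integrable_def by auto
  show "(\<lambda>x. f x * g x) \<in> borel_measurable M"
    using assms unfolding square_integrable_def by auto
  have "\<bar>a * b\<bar> \<le> \<bar>a\<^sup>2 + b\<^sup>2\<bar>" for a b :: real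
  proof -
    have "2 * \<bar>a * b\<bar> \<le> a\<^sup>2 + b\<^sup>2"
      using zero_le_power2[of "\<bar>a\<bar> - \<bar>b\<bar>"] by (simp add: power2_diff abs_mult)
    then show ?thesis by linarith
  qed
  then show "AE x in M. norm (f x * g x) \<le> norm ((f x)\<^sup>2 + (g x)\<^sup>2)"
    by simp
qed

lemma square_integrable_add:
  assumes "square_integrable M f" "square_integrable M g"
  shows "square_integrable M (\<lambda>x. f x + g x)"
  using assms square_integrable_mult[OF assms]
  unfolding square_integrable_def by (auto simp: power2_sum mult.assoc)

lemma square_integrable_scale:
  "square_integrable M f \<Longrightarrow> square_integrable M (\<lambda>x. c * f x)"
  unfolding square_integrable_def by (auto simp: power_mult_distrib)

lemma square_integrable_diff:
  assumes "square_integrable M f" "square_integrable M g"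
  shows "square_integrable M (\<lambda>x. f x - g x)"
  using square_integrable_add[OF assms(1) square_integrable_scale[OF assms(2), of "-1"]] by simp

lemma square_integrable_sum:
  assumes "\<And>i. i \<in> I \<Longrightarrow> square_integrable M (f i)"
  shows "square_integrable M (\<lambda>x. \<Sum>i\<in>I. f i x)"
  using assms
proof (induction I rule: infinite_finite_induct)
  case (insert i I)
  then show ?case by (simp add: square_integrable_add)
qed (auto simp: square_integrable_def)

lemma integral_square_add_le:
  assumes "square_integrable M f" "square_integrable M g"
  shows "(LINT x|M. (f x + g x)\<^sup>2) \<le> 2 * (LINT x|M. (f x)\<^sup>2) + 2 * (LINT x|M. (g x)\<^sup>2)"
proof -
  have "(LINT x|M. (f x + g x)\<^sup>2) \<le> (LINT x|M. 2 * (f x)\<^sup>2 + 2 * (g x)\<^sup>2)"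
    using assms square_integrable_add[OF assms]
    by (intro integral_mono sum_squared_le) (auto simp: square_integrable_def)
  also have "\<dots> = 2 * (LINT x|M. (f x)\<^sup>2) + 2 * (LINT x|M. (g x)\<^sup>2)"
    using assms by (subst Bochner_Integration.integral_add) (auto simp: square_integrable_def)
  finally show ?thesis .
qed

lemma sum_pad:
  fixes u f :: "'b \<Rightarrow> 'c::comm_semiring_1"
  assumes "finite A" "B \<subseteq> A"
  shows "(\<Sum>x\<in>A. (if x \<in> B then u x else 0) * f x) = (\<Sum>x\<in>B. u x * f x)"
  using assms by (intro sum.mono_neutral_cong_right) auto

lemma sum_lessThan_pad:
  fixes u f :: "nat \<Rightarrow> 'c::comm_semiring_1"
  assumes "L \<le> N"
  shows "(\<Sum>n<N. (if n < L then u n else 0) * f n) = (\<Sum>n<L. u n * f n)"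
  using sum_pad[of "{..<N}" "{..<L}" u f] assms by simp

context
  fixes M :: "'a measure" and \<phi> :: "nat \<Rightarrow> 'a \<Rightarrow> real"
  assumes \<phi>: "\<And>n. square_integrable M (\<phi> n)"
begin

lemma square_integrable_partial_sum: "square_integrable M (\<lambda>x. \<Sum>n<N. d n * \<phi> n x)"
  by (intro square_integrable_sum square_integrable_scale \<phi>)

lemma L2_approximable_limit:
  assumes f: "square_integrable M f"
    and lim: "\<And>\<epsilon>. \<epsilon> > 0 \<Longrightarrow> \<exists>g. square_integrable M g \<and> L2_approximable M \<phi> g \<and> (LINT x|M. (f x - g x)\<^sup>2) < \<epsilon>"
  shows "L2_approximable M \<phi> f"
  unfolding L2_approximable_def
proof (intro allI impI)
  fix \<epsilon> :: real assume "\<epsilon> > 0"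
  then obtain g where g: "square_integrable M g" "L2_approximable M \<phi> g" "(LINT x|M. (f x - g x)\<^sup>2) < \<epsilon> / 4"
    using lim[of "\<epsilon> / 4"] by auto
  then obtain d N where dN: "(LINT x|M. (g x - (\<Sum>n<N. d n * \<phi> n x))\<^sup>2) < \<epsilon> / 4"
    unfolding L2_approximable_def using \<open>\<epsilon> > 0\<close> by (meson divide_pos_pos zero_less_numeral)
  have "(LINT x|M. (f x - (\<Sum>n<N. d n * \<phi> n x))\<^sup>2)
      = (LINT x|M. ((f x - g x) + (g x - (\<Sum>n<N. d n * \<phi> n x)))\<^sup>2)"
    by simp
  also have "\<dots> \<le> 2 * (LINT x|M. (f x - g x)\<^sup>2) + 2 * (LINT x|M. (g x - (\<Sum>n<N. d n * \<phi> n x))\<^sup>2)"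
    by (intro integral_square_add_le square_integrable_diff square_integrable_partial_sum f g)
  also have "\<dots> < \<epsilon>"
    using g(3) dN by simp
  finally show "\<exists>d N. (LINT x|M. (f x - (\<Sum>n<N. d n * \<phi> n x))\<^sup>2) < \<epsilon>"
    by blast
qed

lemma L2_approximable_add:
  assumes f: "square_integrable M f" "L2_approximable M \<phi> f"
    and g: "square_integrable M g" "L2_approximable M \<phi> g"
  shows "L2_approximable M \<phi> (\<lambda>x. f x + g x)"
  unfolding L2_approximable_def
proof (intro allI impI)
  fix \<epsilon> :: real assume "\<epsilon> > 0"
  then have pos: "\<epsilon> / 4 > 0" by simp
  obtain d N where dN: "(LINT x|M. (f x - (\<Sum>n<N. d n * \<phi> n x))\<^sup>2) < \<epsilon> / 4"
    using f(2) pos unfolding L2_approximable_def by blast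
  obtain e K where eK: "(LINT x|M. (g x - (\<Sum>n<K. e n * \<phi> n x))\<^sup>2) < \<epsilon> / 4"
    using g(2) pos unfolding L2_approximable_def by blast
  define c where "c n = (if n < N then d n else 0) + (if n < K then e n else 0)" for n
  have "(\<Sum>n<max N K. c n * \<phi> n x) = (\<Sum>n<N. d n * \<phi> n x) + (\<Sum>n<K. e n * \<phi> n x)" for x
    unfolding c_def distrib_right sum.distrib by (simp add: sum_lessThan_pad)
  then have "(LINT x|M. (f x + g x - (\<Sum>n<max N K. c n * \<phi> n x))\<^sup>2)
      = (LINT x|M. ((f x - (\<Sum>n<N. d n * \<phi> n x)) + (g x - (\<Sum>n<K. e n * \<phi> n x)))\<^sup>2)"
    by (intro arg_cong[of _ _ "integral\<^sup>L M"]) (simp add: fun_eq_iff algebra_simps)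
  also have "\<dots> \<le> 2 * (LINT x|M. (f x - (\<Sum>n<N. d n * \<phi> n x))\<^sup>2)
      + 2 * (LINT x|M. (g x - (\<Sum>n<K. e n * \<phi> n x))\<^sup>2)"
    by (intro integral_square_add_le square_integrable_diff square_integrable_partial_sum f g)
  also have "\<dots> < \<epsilon>"
    using dN eK by simp
  finally show "\<exists>d N. (LINT x|M. (f x + g x - (\<Sum>n<N. d n * \<phi> n x))\<^sup>2) < \<epsilon>"
    by blast
qed

lemma L2_approximable_scale:
  assumes f: "L2_approximable M \<phi> f"
  shows "L2_approximable M \<phi> (\<lambda>x. c * f x)"
  unfolding L2_approximable_def
proof (intro allI impI)
  fix \<epsilon> :: real assume "\<epsilon> > 0"
  then have pos: "\<epsilon> / (c\<^sup>2 + 1) > 0"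
    by (simp add: add_nonneg_pos)
  obtain d N where dN: "(LINT x|M. (f x - (\<Sum>n<N. d n * \<phi> n x))\<^sup>2) < \<epsilon> / (c\<^sup>2 + 1)"
    using f pos unfolding L2_approximable_def by blast
  have "(LINT x|M. (c * f x - (\<Sum>n<N. c * d n * \<phi> n x))\<^sup>2)
      = (LINT x|M. c\<^sup>2 * (f x - (\<Sum>n<N. d n * \<phi> n x))\<^sup>2)"
    by (simp add: power_mult_distrib[symmetric] sum_distrib_left right_diff_distrib mult.assoc)
  also have "\<dots> = c\<^sup>2 * (LINT x|M. (f x - (\<Sum>n<N. d n * \<phi> n x))\<^sup>2)"
    by simp
  also have "\<dots> \<le> (c\<^sup>2 + 1) * (LINT x|M. (f x - (\<Sum>n<N. d n * \<phi> n x))\<^sup>2)"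
    by (intro mult_right_mono) auto
  also have "\<dots> < \<epsilon>"
    using dN by (simp add: less_divide_eq add_nonneg_pos mult.commute)
  finally show "\<exists>d N. (LINT x|M. (c * f x - (\<Sum>n<N. d n * \<phi> n x))\<^sup>2) < \<epsilon>"
    by (intro exI[of _ "\<lambda>n. c * d n"] exI[of _ N])
qed

lemma L2_approximable_sum:
  fixes e :: "nat \<Rightarrow> 'a \<Rightarrow> real" and k :: nat
  assumes "\<And>j. square_integrable M (e j)" "\<And>j. L2_approximable M \<phi> (e j)"
  shows "L2_approximable M \<phi> (\<lambda>x. \<Sum>j<k. c j * e j x)"
proof (induction k)
  case 0
  show ?case
    unfolding L2_approximable_def by (auto intro!: exI[of _ "0::nat"])
next
  case (Suc k)
  then show ?case
    by (simp add: L2_approximable_add L2_approximable_scale assms square_integrable_sum square_integrable_scale)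
qed

lemma L2_approximable_trans:
  assumes f: "square_integrable M f" "L2_approximable M e f"
    and e: "\<And>j. square_integrable M (e j)" "\<And>j. L2_approximable M \<phi> (e j)"
  shows "L2_approximable M \<phi> f"
proof (rule L2_approximable_limit[OF f(1)])
  fix \<epsilon> :: real assume "\<epsilon> > 0"
  then obtain c k where "(LINT x|M. (f x - (\<Sum>j<k. c j * e j x))\<^sup>2) < \<epsilon>"
    using f(2) unfolding L2_approximable_def by blast
  moreover have "square_integrable M (\<lambda>x. \<Sum>j<k. c j * e j x)"
    by (intro square_integrable_sum square_integrable_scale e)
  ultimately show "\<exists>g. square_integrable M g \<and> L2_approximable M \<phi> g \<and> (LINT x|M. (f x - g x)\<^sup>2) < \<epsilon>"
    using L2_approximable_sum[where e = e and k = k and c = c, OF e] by blast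
qed

text \<open>
  The residual after \<open>N\<close> terms is orthogonal to \<open>\<phi> n\<close> for \<open>n < N\<close>, so its product with \<open>\<phi> N\<close> integrates
  to the full Fourier coefficient \<open>c N\<close>; subtracting the next term lowers the square norm by
  \<open>(c N)\<^sup>2 / h N\<close>.
\<close>

lemma bessel_identity:
  assumes f: "square_integrable M f"
    and orth: "\<And>m n. (LINT x|M. \<phi> m x * \<phi> n x) = (if m = n then h n else 0)"
    and h: "\<And>n. h n \<noteq> 0"
    and c: "\<And>n. (LINT x|M. f x * \<phi> n x) = c n"
  shows "(LINT x|M. (f x - (\<Sum>n<N. c n / h n * \<phi> n x))\<^sup>2) = (LINT x|M. (f x)\<^sup>2) - (\<Sum>n<N. (c n)\<^sup>2 / h n)"
proof (induction N)
  case (Suc N)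
  let ?r = "\<lambda>x. f x - (\<Sum>n<N. c n / h n * \<phi> n x)" and ?d = "c N / h N"
  have r: "square_integrable M ?r"
    by (intro square_integrable_diff square_integrable_partial_sum f)
  have int: "integrable M (\<lambda>x. f x * \<phi> N x)" "integrable M (\<lambda>x. \<phi> n x * \<phi> N x)" for n
    by (intro square_integrable_mult f \<phi>)+
  have "(LINT x|M. ?r x * \<phi> N x) = (LINT x|M. f x * \<phi> N x - (\<Sum>n<N. c n / h n * (\<phi> n x * \<phi> N x)))"
    by (simp add: left_diff_distrib sum_distrib_right mult.assoc)
  also have "\<dots> = c N - (\<Sum>n<N. c n / h n * (LINT x|M. \<phi> n x * \<phi> N x))"
    using int c by (subst Bochner_Integration.integral_diff) auto
  also have "(\<Sum>n<N. c n / h n * (LINT x|M. \<phi> n x * \<phi> N x)) = 0"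
    by (intro sum.neutral) (simp add: orth)
  finally have rN: "(LINT x|M. ?r x * \<phi> N x) = c N" by simp
  have "(LINT x|M. (f x - (\<Sum>n<Suc N. c n / h n * \<phi> n x))\<^sup>2)
      = (LINT x|M. (?r x)\<^sup>2 - 2 * ?d * (?r x * \<phi> N x) + ?d\<^sup>2 * (\<phi> N x * \<phi> N x))"
    by (intro arg_cong[of _ _ "integral\<^sup>L M"]) (simp add: fun_eq_iff power2_eq_square algebra_simps)
  also have "\<dots> = (LINT x|M. (?r x)\<^sup>2) - 2 * ?d * (LINT x|M. ?r x * \<phi> N x) + ?d\<^sup>2 * (LINT x|M. \<phi> N x * \<phi> N x)"
    using r square_integrable_mult[OF r \<phi>[of N]] square_integrable_mult[OF \<phi>[of N] \<phi>[of N]]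
    by (simp add: square_integrable_def)
  also have "\<dots> = (LINT x|M. (f x)\<^sup>2) - (\<Sum>n<Suc N. (c n)\<^sup>2 / h n)"
    unfolding rN orth Suc.IH using h[of N] by (simp add: power2_eq_square field_simps)
  finally show ?case .
qed simp

text \<open>
  By Bessel's identity the approximation errors of the Fourier expansion are the remainders of the series in
  Parseval's identity.
\<close>

lemma L2_approximable_if_parseval:
  assumes f: "square_integrable M f"
    and orth: "\<And>m n. (LINT x|M. \<phi> m x * \<phi> n x) = (if m = n then h n else 0)"
    and h: "\<And>n. h n \<noteq> 0"
    and c: "\<And>n. (LINT x|M. f x * \<phi> n x) = c n"
    and parseval: "(\<lambda>n. (c n)\<^sup>2 / h n) sums (LINT x|M. (f x)\<^sup>2)"
  shows "L2_approximable M \<phi> f"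
  unfolding L2_approximable_def
proof (intro allI impI)
  fix \<epsilon> :: real assume "\<epsilon> > 0"
  have "(\<lambda>N. (LINT x|M. (f x)\<^sup>2) - (\<Sum>n<N. (c n)\<^sup>2 / h n)) \<longlonglongrightarrow> (LINT x|M. (f x)\<^sup>2) - (LINT x|M. (f x)\<^sup>2)"
    using parseval unfolding sums_def by (intro tendsto_diff tendsto_const)
  then have "(\<lambda>N. LINT x|M. (f x - (\<Sum>n<N. c n / h n * \<phi> n x))\<^sup>2) \<longlonglongrightarrow> 0"
    unfolding bessel_identity[OF f orth h c] by simp
  from order_tendstoD(2)[OF this \<open>\<epsilon> > 0\<close>]
  have "\<forall>\<^sub>F N in sequentially. (LINT x|M. (f x - (\<Sum>n<N. c n / h n * \<phi> n x))\<^sup>2) < \<epsilon>" .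
  then obtain N where "(LINT x|M. (f x - (\<Sum>n<N. c n / h n * \<phi> n x))\<^sup>2) < \<epsilon>"
    by (auto simp: eventually_sequentially)
  then show "\<exists>d N. (LINT x|M. (f x - (\<Sum>n<N. d n * \<phi> n x))\<^sup>2) < \<epsilon>"
    by (intro exI[of _ "\<lambda>n. c n / h n"] exI[of _ N])
qed

end

lemma L2_approximable_dominated:
  assumes \<phi>: "\<And>n. square_integrable M (\<phi> n)"
    and f: "square_integrable M f"
    and g: "\<And>i. square_integrable M (g i)" "\<And>i. L2_approximable M \<phi> (g i)"
    and lim: "AE x in M. (\<lambda>i. g i x) \<longlonglongrightarrow> f x"
    and bound: "integrable M b" "\<And>i. AE x in M. (f x - g i x)\<^sup>2 \<le> b x"
  shows "L2_approximable M \<phi> f"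
proof (rule L2_approximable_limit[OF \<phi> f])
  fix \<epsilon> :: real assume "\<epsilon> > 0"
  have "(\<lambda>i. LINT x|M. (f x - g i x)\<^sup>2) \<longlonglongrightarrow> (LINT x|M. (0::real))"
  proof (rule integral_dominated_convergence[where w = b])
    show "AE x in M. (\<lambda>i. (f x - g i x)\<^sup>2) \<longlonglongrightarrow> 0"
      using lim
    proof eventually_elim
      fix x assume "(\<lambda>i. g i x) \<longlonglongrightarrow> f x"
      then have "(\<lambda>i. (f x - g i x)\<^sup>2) \<longlonglongrightarrow> (f x - f x)\<^sup>2"
        by (intro tendsto_intros)
      then show "(\<lambda>i. (f x - g i x)\<^sup>2) \<longlonglongrightarrow> 0" by simp
    qed
    show "AE x in M. norm ((f x - g i x)\<^sup>2) \<le> b x" for i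
      using bound(2)[of i] by simp
    show "(\<lambda>x. (f x - g i x)\<^sup>2) \<in> borel_measurable M" for i
      using square_integrable_diff[OF f g(1)[of i]] unfolding square_integrable_def
      by (intro borel_measurable_power) blast
  qed (simp_all add: bound(1))
  then have "(\<lambda>i. LINT x|M. (f x - g i x)\<^sup>2) \<longlonglongrightarrow> 0" by simp
  from order_tendstoD(2)[OF this \<open>\<epsilon> > 0\<close>]
  obtain i where "(LINT x|M. (f x - g i x)\<^sup>2) < \<epsilon>"
    by (auto simp: eventually_sequentially)
  then show "\<exists>h. square_integrable M h \<and> L2_approximable M \<phi> h \<and> (LINT x|M. (f x - h x)\<^sup>2) < \<epsilon>"
    using g by blast
qed

lemma (in finite_measure) square_integrable_bounded:
  assumes "f \<in> borel_measurable M" "\<And>x. x \<in> space M \<Longrightarrow> \<bar>f x\<bar> \<le> C"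
  shows "square_integrable M f"
  unfolding square_integrable_def
proof (intro conjI integrable_const_bound[where B = "C\<^sup>2"])
  show "AE x in M. norm ((f x)\<^sup>2) \<le> C\<^sup>2"
  proof (rule AE_I2)
    fix x assume "x \<in> space M"
    from power_mono[OF assms(2)[OF this], of 2] show "norm ((f x)\<^sup>2) \<le> C\<^sup>2" by simp
  qed
qed (use assms in auto)

section \<open>Density of exponentials\<close>

text \<open>
  The substitution \<open>y = exp (- \<kappa> x)\<close> maps the positive half-line into \<open>[0,1]\<close>. Because \<open>g\<close> vanishes
  beyond \<open>R\<close>, it becomes a function of \<open>y\<close> that extends continuously by \<open>0\<close> to \<open>y = 0\<close>, and Weierstrass'
  theorem applies.
\<close>

lemma uniform_approx_exp_polynomial:
  fixes g :: "real \<Rightarrow> real"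
  assumes g: "continuous_on UNIV g" and van: "\<And>x. R \<le> x \<Longrightarrow> g x = 0" and "0 < \<kappa>" "0 < \<epsilon>"
  obtains d N where "\<And>x. 0 < x \<Longrightarrow> \<bar>g x - (\<Sum>j<N. d j * exp (- \<kappa> * x) ^ j)\<bar> < \<epsilon>"
proof -
  define \<delta> where "\<delta> = exp (- \<kappa> * R)"
  \<comment> \<open>Truncating \<open>y\<close> from below at \<open>\<delta>\<close>, where \<open>g\<close> has the value \<open>g R = 0\<close>, makes the extension continuous.\<close>
  define H where "H y = g (- ln (max y \<delta>) / \<kappa>)" for y
  have "continuous_on {0..1} H"
    unfolding H_def
  proof (rule continuous_on_compose2[OF g])
    have "0 < \<delta>" by (simp add: \<delta>_def)
    then have "max y \<delta> \<noteq> 0" for y by linarith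
    then show "continuous_on {0..1} (\<lambda>y. - ln (max y \<delta>) / \<kappa>)"
      using \<open>0 < \<kappa>\<close> by (intro continuous_intros) auto
  qed auto
  then obtain p where p: "real_polynomial_function p" "\<And>y. y \<in> {0..1} \<Longrightarrow> \<bar>H y - p y\<bar> < \<epsilon>"
    using Stone_Weierstrass_real_polynomial_function[OF compact_Icc _ \<open>0 < \<epsilon>\<close>] by metis
  obtain d N where dN: "p = (\<lambda>y. \<Sum>j\<le>N. d j * y ^ j)"
    using p(1) unfolding real_polynomial_function_iff_sum by blast
  have "\<bar>g x - (\<Sum>j<Suc N. d j * exp (- \<kappa> * x) ^ j)\<bar> < \<epsilon>" if "0 < x" for x
  proof -
    have "H (exp (- \<kappa> * x)) = g x"
    proof (cases "x \<le> R")
      case True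
      then have "max (exp (- \<kappa> * x)) \<delta> = exp (- \<kappa> * x)"
        unfolding \<delta>_def using \<open>0 < \<kappa>\<close> by (simp add: max_def)
      then show ?thesis unfolding H_def using \<open>0 < \<kappa>\<close> by simp
    next
      case False
      then have "max (exp (- \<kappa> * x)) \<delta> = \<delta>"
        unfolding \<delta>_def using \<open>0 < \<kappa>\<close> by (simp add: max_def)
      then show ?thesis unfolding H_def \<delta>_def using \<open>0 < \<kappa>\<close> False van by simp
    qed
    then show ?thesis
      using p(2)[of "exp (- \<kappa> * x)"] \<open>0 < \<kappa>\<close> that unfolding dN lessThan_Suc_atMost by simp
  qed
  then show ?thesis using that by blast
qed

text \<open>
  The function is reduced in three steps, each justified by dominated convergence or finiteness
  of the measure: truncation makes it bounded; a bounded measurable function is an almost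
  everywhere limit of continuous functions, which may be clamped to the same bound and cut off at
  infinity; and a continuous function that vanishes far out is uniformly approximated by
  polynomials in \<open>exp (- \<kappa> t)\<close>.
\<close>

lemma L2_approximable_exponentials:
  fixes w :: "real \<Rightarrow> ennreal"
  defines "M \<equiv> density (lebesgue_on {0<..}) w"
  assumes w: "w \<in> borel_measurable (lebesgue_on {0<..})" and "finite_measure M" and \<kappa>: "0 < \<kappa>"
    and f: "square_integrable M f"
  shows "L2_approximable M (\<lambda>j t. exp (- \<kappa> * t) ^ j) f"
proof -
  interpret finite_measure M by fact
  let ?e = "\<lambda>j t. exp (- \<kappa> * t) ^ j :: real"
  have space_M: "space M = {0<..}"
    by (simp add: M_def)
  have meas_M: "h \<in> borel_measurable M" if "h \<in> borel_measurable borel" for h :: "real \<Rightarrow> real"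
    unfolding M_def using that by (simp add: measurable_lebesgue_on_borel)
  have e: "square_integrable M (?e j)" for j
  proof (rule square_integrable_bounded[where C = 1])
    show "\<bar>?e j t\<bar> \<le> 1" if "t \<in> space M" for t
      using that \<kappa> by (simp add: space_M power_le_one)
  qed (intro meas_M, measurable)
  have compact: "L2_approximable M ?e g"
    if g: "continuous_on UNIV g" "\<And>x. R \<le> x \<Longrightarrow> g x = 0" for g :: "real \<Rightarrow> real" and R
    unfolding L2_approximable_def
  proof (intro allI impI)
    fix \<epsilon> :: real assume "\<epsilon> > 0"
    \<comment> \<open>A uniform error \<open>\<eta>\<close> costs at most \<open>\<eta>\<^sup>2\<close> times the total mass; the summand 1 covers the case of mass zero.\<close>
    define \<eta> where "\<eta> = sqrt (\<epsilon> / (measure M (space M) + 1))"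
    have pos: "measure M (space M) + 1 > 0"
      by (simp add: add_nonneg_pos)
    have "\<eta> > 0"
      using \<open>\<epsilon> > 0\<close> pos by (simp add: \<eta>_def)
    obtain d N where dN: "\<And>x. 0 < x \<Longrightarrow> \<bar>g x - (\<Sum>j<N. d j * ?e j x)\<bar> < \<eta>"
      using uniform_approx_exp_polynomial[OF g \<kappa> \<open>\<eta> > 0\<close>] by blast
    let ?r = "\<lambda>x. g x - (\<Sum>j<N. d j * ?e j x)"
    have "square_integrable M ?r"
    proof (rule square_integrable_bounded)
      show "?r \<in> borel_measurable M"
        using g(1) by (intro meas_M borel_measurable_continuous_onI continuous_intros)
      show "\<bar>?r x\<bar> \<le> \<eta>" if "x \<in> space M" for x
        using dN[of x] that by (simp add: space_M)
    qed
    moreover have "(?r x)\<^sup>2 \<le> \<eta>\<^sup>2" if "x \<in> space M" for x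
      using power_mono[of "\<bar>?r x\<bar>" \<eta> 2] dN[of x] that by (simp add: space_M)
    ultimately have "(LINT x|M. (?r x)\<^sup>2) \<le> (LINT x|M. \<eta>\<^sup>2)"
      by (intro integral_mono) (auto simp: square_integrable_def)
    also have "\<dots> = \<epsilon> * (measure M (space M) / (measure M (space M) + 1))"
      using \<open>\<epsilon> > 0\<close> pos by (simp add: \<eta>_def)
    also have "\<dots> < \<epsilon> * 1"
      using \<open>\<epsilon> > 0\<close> pos by (intro mult_strict_left_mono) auto
    finally show "\<exists>d N. (LINT x|M. (g x - (\<Sum>j<N. d j * ?e j x))\<^sup>2) < \<epsilon>"
      by auto
  qed
  have bounded: "L2_approximable M ?e g"
    if g: "g \<in> borel_measurable M" "\<And>x. \<bar>g x\<bar> \<le> C" for g C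
  proof -
    have C: "C \<ge> 0" using g(2)[of 0] by simp
    have "g \<in> borel_measurable (lebesgue_on {0<..})"
      using g(1) by (simp add: M_def)
    then have "g measurable_on {0<..}"
      by (subst measurable_on_iff_borel_measurable) auto
    then obtain S u where S: "negligible S" and u: "\<And>i. continuous_on UNIV (u i)"
      and lim: "\<And>x. x \<notin> S \<Longrightarrow> (\<lambda>i. u i x) \<longlonglongrightarrow> (if x \<in> {0<..} then g x else 0)"
      unfolding measurable_on_def by blast
    \<comment> \<open>The first factor keeps the bound \<open>C\<close>; the second is a continuous cutoff, zero from \<open>i\<close> on and tending to 1.\<close>
    define v where "v i x = max (- C) (min C (u i x)) * max 0 (min 1 (real i - x))" for i :: nat and x
    have v_le: "\<bar>v i x\<bar> \<le> C" for i x
    proof -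
      have "\<bar>max (- C) (min C (u i x))\<bar> * \<bar>max 0 (min 1 (real i - x))\<bar> \<le> C * 1"
        using C by (intro mult_mono) auto
      then show ?thesis by (simp add: v_def abs_mult)
    qed
    have v_cont: "continuous_on UNIV (v i)" for i
      unfolding v_def by (intro continuous_intros u)
    show ?thesis
    proof (rule L2_approximable_dominated[where g = v and b = "\<lambda>_. (2 * C)\<^sup>2"])
      show "square_integrable M (v i)" for i
        by (rule square_integrable_bounded[OF meas_M v_le])
           (auto intro: borel_measurable_continuous_onI v_cont)
      show "L2_approximable M ?e (v i)" for i
        by (rule compact[OF v_cont, of "real i"]) (simp add: v_def)
      show "square_integrable M g"
        by (rule square_integrable_bounded[OF g])
      have "AE x in lebesgue. x \<notin> S"
        using S by (simp add: negligible_iff_null_sets AE_not_in)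
      then have "AE x in lebesgue_on {0<..}. x \<notin> S"
        by (subst AE_restrict_space_iff) auto
      then have "AE x in M. x \<notin> S"
        unfolding M_def using w by (subst AE_density) auto
      then show "AE x in M. (\<lambda>i. v i x) \<longlonglongrightarrow> g x"
        using AE_space
      proof eventually_elim
        fix x assume x: "x \<notin> S" "x \<in> space M"
        then have "(\<lambda>i. u i x) \<longlonglongrightarrow> g x"
          using lim[of x] by (simp add: space_M)
        then have 1: "(\<lambda>i. max (- C) (min C (u i x))) \<longlonglongrightarrow> max (- C) (min C (g x))"
          by (intro tendsto_intros)
        have 2: "max (- C) (min C (g x)) = g x"
          using g(2)[of x] by (simp add: abs_le_iff)
        have 3: "(\<lambda>i. max 0 (min 1 (real i - x))) \<longlonglongrightarrow> 1"
        proof (rule tendsto_eventually)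
          obtain k :: nat where "x + 1 \<le> real k" using real_arch_simple by blast
          then show "\<forall>\<^sub>F i in sequentially. max 0 (min 1 (real i - x)) = 1"
            unfolding eventually_sequentially by (intro exI[of _ k]) auto
        qed
        show "(\<lambda>i. v i x) \<longlonglongrightarrow> g x"
          unfolding v_def using tendsto_mult[OF 1 3] by (simp add: 2)
      qed
      show "AE x in M. (g x - v i x)\<^sup>2 \<le> (2 * C)\<^sup>2" for i
      proof (rule AE_I2)
        fix x
        have "\<bar>g x - v i x\<bar> \<le> 2 * C" using g(2)[of x] v_le[of i x] by linarith
        from power_mono[OF this, of 2] show "(g x - v i x)\<^sup>2 \<le> (2 * C)\<^sup>2" by simp
      qed
    qed (rule e, rule integrable_const)
  qed
  let ?t = "\<lambda>i x. max (- real i) (min (real i) (f x))"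
  have t_meas: "?t i \<in> borel_measurable M" for i
    using f unfolding square_integrable_def
    by (intro borel_measurable_max borel_measurable_min borel_measurable_const) blast+
  have t_le: "\<bar>?t i x\<bar> \<le> real i" for i x
    by (simp add: abs_le_iff)
  show ?thesis
  proof (rule L2_approximable_dominated[where g = ?t and b = "\<lambda>x. (f x)\<^sup>2"])
    show "square_integrable M (?t i)" for i
      by (rule square_integrable_bounded[OF t_meas t_le])
    show "L2_approximable M ?e (?t i)" for i
      by (rule bounded[OF t_meas t_le])
    show "AE x in M. (\<lambda>i. ?t i x) \<longlonglongrightarrow> f x"
    proof (rule AE_I2, rule tendsto_eventually)
      fix x
      obtain k :: nat where "\<bar>f x\<bar> \<le> real k" using real_arch_simple by blast
      then show "\<forall>\<^sub>F i in sequentially. ?t i x = f x"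
        unfolding eventually_sequentially by (intro exI[of _ k]) auto
    qed
    show "AE x in M. (f x - ?t i x)\<^sup>2 \<le> (f x)\<^sup>2" for i
    proof (rule AE_I2)
      fix x
      have "\<bar>f x - ?t i x\<bar> \<le> \<bar>f x\<bar>" by linarith
      then show "(f x - ?t i x)\<^sup>2 \<le> (f x)\<^sup>2" by (simp add: abs_le_square_iff)
    qed
    show "integrable M (\<lambda>x. (f x)\<^sup>2)"
      using f by (simp add: square_integrable_def)
  qed (rule e, rule f)
qed

section \<open>Completeness of the Laguerre polynomials\<close>

lemma finite_measure_laguerre_measure: "finite_measure (laguerre_measure a)"
proof
  have "integrable (laguerre_measure a) (\<lambda>t. 1 :: real)"
    using has_bochner_integral_laguerre_measure[of 0 a 0] by (auto simp: has_bochner_integral_iff)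
  then show "emeasure (laguerre_measure a) (space (laguerre_measure a)) \<noteq> \<infinity>"
    by (simp add: integrable_iff_bounded top_unique less_top)
qed

lemma measurable_laguerre_measure: "borel_measurable (laguerre_measure a) = borel_measurable (lebesgue_on {0<..})"
  unfolding laguerre_measure_def by (rule measurable_cong_sets) (rule sets_density, rule refl)

lemma square_integrable_laguerre:
  "square_integrable (laguerre_measure a) (\<lambda>t. laguerre n (real a) (2 * t))"
  unfolding square_integrable_def
proof
  show "(\<lambda>t. laguerre n (real a) (2 * t)) \<in> borel_measurable (laguerre_measure a)"
    unfolding measurable_laguerre_measure laguerre_eq by (intro measurable_lebesgue_on_borel) measurable
  show "integrable (laguerre_measure a) (\<lambda>t. (laguerre n (real a) (2 * t))\<^sup>2)"
    using has_bochner_integral_laguerre_laguerre[of a n n]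
    by (auto simp: has_bochner_integral_iff power2_eq_square)
qed

text \<open>
  The exponentials \<open>exp (- 2 t) ^ j\<close> are dense, so it suffices to approximate each of them. With
  \<open>s = j\<close> and \<open>q = s / (1 + s)\<close>, Parseval's identity is the negative binomial series at \<open>q\<^sup>2\<close>, whose sum
  agrees with the square norm since \<open>(1 + s)\<^sup>2 (1 - q\<^sup>2) = 1 + 2 s\<close>.
\<close>

lemma L2_approximable_laguerre:
  assumes f: "square_integrable (laguerre_measure a) f"
  shows "L2_approximable (laguerre_measure a) (\<lambda>n t. laguerre n (real a) (2 * t)) f"
proof (rule L2_approximable_trans[where e = "\<lambda>j t. exp (- 2 * t) ^ j"])
  let ?M = "laguerre_measure a"
  have exp_power: "exp (- 2 * t) ^ j = exp (- (2 * real j * t))" for t :: real and j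
    by (simp add: exp_of_nat_mult[symmetric] mult_ac)
  have exp_power2: "(exp (- 2 * t) ^ j)\<^sup>2 = exp (- (2 * (2 * real j) * t))" for t :: real and j
    unfolding exp_power by (simp add: power2_eq_square exp_add[symmetric])
  have exp_norm: "has_bochner_integral ?M (\<lambda>t. (exp (- 2 * t) ^ j)\<^sup>2) (fact a / (1 + 2 * real j) ^ (a + 1))" for j
    unfolding exp_power2 using has_bochner_integral_laguerre_measure[of "2 * real j" a 0] by simp
  show "L2_approximable ?M (\<lambda>j t. exp (- 2 * t) ^ j) f"
    unfolding laguerre_measure_def
  proof (rule L2_approximable_exponentials)
    show "(\<lambda>t. ennreal (2 * (2 * t) ^ a * exp (- 2 * t))) \<in> borel_measurable (lebesgue_on {0<..})"
      by (intro measurable_compose[OF _ measurable_ennreal] measurable_lebesgue_on_borel) measurable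
  qed (use f finite_measure_laguerre_measure in \<open>auto simp: laguerre_measure_def\<close>)
  show sq: "square_integrable ?M (\<lambda>t. exp (- 2 * t) ^ j)" for j
  proof -
    have "(\<lambda>t. exp (- 2 * t) ^ j :: real) \<in> borel_measurable ?M"
      unfolding measurable_laguerre_measure by (intro measurable_lebesgue_on_borel) measurable
    then show ?thesis
      unfolding square_integrable_def using exp_norm[of j] by (simp add: has_bochner_integral_iff)
  qed
  show "L2_approximable ?M (\<lambda>n t. laguerre n (real a) (2 * t)) (\<lambda>t. exp (- 2 * t) ^ j)" for j
  proof (rule L2_approximable_if_parseval[OF square_integrable_laguerre sq])
    let ?s = "real j" and ?h = "\<lambda>n. fact (n + a) / fact n :: real"
    let ?q = "?s / (1 + ?s)"
    let ?c = "\<lambda>n. ?h n * ?q ^ n / (1 + ?s) ^ (a + 1)"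
    show "(LINT t|?M. laguerre m (real a) (2 * t) * laguerre n (real a) (2 * t)) = (if m = n then ?h n else 0)" for m n
      by (rule has_bochner_integral_integral_eq[OF has_bochner_integral_laguerre_laguerre])
    show "?h n \<noteq> 0" for n by simp
    show "(LINT t|?M. exp (- 2 * t) ^ j * laguerre n (real a) (2 * t)) = ?c n" for n
      unfolding exp_power by (rule has_bochner_integral_integral_eq[OF has_bochner_integral_exp_laguerre]) simp
    have one: "(1 + ?s)\<^sup>2 * (1 - ?q\<^sup>2) = 1 + 2 * ?s"
    proof -
      have "(1 + ?s) * ?q = ?s" by (simp add: field_simps)
      then have "(1 + ?s)\<^sup>2 * ?q\<^sup>2 = ?s\<^sup>2" by (metis power_mult_distrib)
      then show ?thesis by (simp add: right_diff_distrib power2_eq_square algebra_simps)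
    qed
    have "\<bar>?q\<^sup>2\<bar> < 1"
      by (simp add: power_less_one_iff abs_square_less_1)
    then have "(\<lambda>n. ?h n * (?q\<^sup>2) ^ n / ((1 + ?s)\<^sup>2) ^ (a + 1)) sums
        (fact a / (1 - ?q\<^sup>2) ^ (a + 1) / ((1 + ?s)\<^sup>2) ^ (a + 1))"
      by (intro sums_divide negative_binomial_sums)
    moreover have "fact a / (1 - ?q\<^sup>2) ^ (a + 1) / ((1 + ?s)\<^sup>2) ^ (a + 1) = fact a / (1 + 2 * ?s) ^ (a + 1)"
      unfolding one[symmetric] power_mult_distrib[of "(1 + ?s)\<^sup>2"] by (simp only: divide_divide_eq_left mult.commute)
    moreover have "?h n * (?q\<^sup>2) ^ n / ((1 + ?s)\<^sup>2) ^ (a + 1) = (?c n)\<^sup>2 / ?h n" for n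
    proof -
      have "x * y\<^sup>2 / z\<^sup>2 = (x * y / z)\<^sup>2 / x" if "x \<noteq> 0" for x y z :: real
        using that by (simp add: power2_eq_square)
      moreover have "(u\<^sup>2) ^ k = (u ^ k)\<^sup>2" for u :: real and k
        by (simp add: power_mult[symmetric] mult.commute)
      moreover have "?h n \<noteq> 0" by simp
      ultimately show ?thesis by (simp only:)
    qed
    ultimately show "(\<lambda>n. (?c n)\<^sup>2 / ?h n) sums (LINT t|?M. (exp (- 2 * t) ^ j)\<^sup>2)"
      using has_bochner_integral_integral_eq[OF exp_norm[of j]] by simp
  qed
qed (rule square_integrable_laguerre, rule f)

section \<open>Orthogonal bases of weighted spaces\<close>

lemma L2_norm_eq: "L2_norm \<Omega> w f = sqrt (LINT t|lebesgue_on \<Omega>. (cmod (f t))\<^sup>2 * w t)"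
proof -
  have "(\<lambda>t. cnj (f t) * f t * complex_of_real (w t)) = (\<lambda>t. complex_of_real ((cmod (f t))\<^sup>2 * w t))"
    by (simp only: of_real_mult complex_norm_square mult.commute)
  then show ?thesis
    unfolding L2_norm_def L2_inner_def by (simp only: integral_complex_of_real Re_complex_of_real)
qed

lemma L2_space_add:
  assumes w: "w \<in> borel_measurable (lebesgue_on \<Omega>)" "\<And>t. 0 \<le> w t"
    and f: "f \<in> L2_space \<Omega> w" and g: "g \<in> L2_space \<Omega> w"
  shows "(\<lambda>t. f t + g t) \<in> L2_space \<Omega> w"
proof -
  have meas: "f \<in> borel_measurable (lebesgue_on \<Omega>)" "g \<in> borel_measurable (lebesgue_on \<Omega>)"
    and int: "integrable (lebesgue_on \<Omega>) (\<lambda>t. (cmod (f t))\<^sup>2 * w t)"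
      "integrable (lebesgue_on \<Omega>) (\<lambda>t. (cmod (g t))\<^sup>2 * w t)"
    using f g by (auto simp: L2_space_def)
  have le: "(cmod (f t + g t))\<^sup>2 * w t \<le> 2 * ((cmod (f t))\<^sup>2 * w t) + 2 * ((cmod (g t))\<^sup>2 * w t)" for t
  proof -
    have "(cmod (f t + g t))\<^sup>2 \<le> (cmod (f t) + cmod (g t))\<^sup>2"
      by (intro power_mono norm_triangle_ineq) simp
    also have "\<dots> \<le> 2 * (cmod (f t))\<^sup>2 + 2 * (cmod (g t))\<^sup>2"
      by (rule sum_squared_le)
    finally have "(cmod (f t + g t))\<^sup>2 * w t \<le> (2 * (cmod (f t))\<^sup>2 + 2 * (cmod (g t))\<^sup>2) * w t"
      by (rule mult_right_mono) (rule w)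
    then show ?thesis by (simp add: algebra_simps)
  qed
  have "integrable (lebesgue_on \<Omega>) (\<lambda>t. (cmod (f t + g t))\<^sup>2 * w t)"
  proof (rule Bochner_Integration.integrable_bound)
    show "integrable (lebesgue_on \<Omega>) (\<lambda>t. 2 * ((cmod (f t))\<^sup>2 * w t) + 2 * ((cmod (g t))\<^sup>2 * w t))"
      using int by simp
    show "AE t in lebesgue_on \<Omega>. norm ((cmod (f t + g t))\<^sup>2 * w t)
        \<le> norm (2 * ((cmod (f t))\<^sup>2 * w t) + 2 * ((cmod (g t))\<^sup>2 * w t))"
      using le w(2) by (intro AE_I2) (simp add: abs_mult)
  qed (use meas w(1) in measurable)
  then show ?thesis
    using meas by (simp add: L2_space_def)
qed

lemma L2_space_scale: "f \<in> L2_space \<Omega> w \<Longrightarrow> (\<lambda>t. k * f t) \<in> L2_space \<Omega> w"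
  unfolding L2_space_def by (auto simp: norm_mult power_mult_distrib mult.assoc)

lemma L2_space_sum:
  assumes w: "w \<in> borel_measurable (lebesgue_on \<Omega>)" "\<And>t. 0 \<le> w t"
    and "\<And>g. g \<in> F \<Longrightarrow> g \<in> L2_space \<Omega> w"
  shows "(\<lambda>t. \<Sum>g\<in>F. c g * g t) \<in> L2_space \<Omega> w"
  using assms(3)
proof (induction F rule: infinite_finite_induct)
  case (insert g F)
  then show ?case by (simp add: L2_space_add[OF w] L2_space_scale)
qed (auto simp: L2_space_def)

lemma L2_space_diff:
  assumes w: "w \<in> borel_measurable (lebesgue_on \<Omega>)" "\<And>t. 0 \<le> w t"
    and "f \<in> L2_space \<Omega> w" "g \<in> L2_space \<Omega> w"
  shows "(\<lambda>t. f t - g t) \<in> L2_space \<Omega> w"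
  using L2_space_add[OF w assms(3) L2_space_scale[OF assms(4), of "-1"]] by simp

text \<open>
  Bases indexed by the naturals, together with their square norms \<open>h\<close>. Coefficients attached to
  indices rather than to functions transfer along \<open>f \<mapsto> (\<lambda>t. k * f (- t))\<close> without inverting that map.
\<close>

definition L2_orthogonal_basis_seq ::
    "real set \<Rightarrow> (real \<Rightarrow> real) \<Rightarrow> (nat \<Rightarrow> real \<Rightarrow> complex) \<Rightarrow> (nat \<Rightarrow> real) \<Rightarrow> bool" where
  "L2_orthogonal_basis_seq \<Omega> w \<psi> h \<longleftrightarrow>
     (\<forall>n. \<psi> n \<in> L2_space \<Omega> w) \<and>
     (\<forall>m n. L2_inner \<Omega> w (\<psi> m) (\<psi> n) = (if m = n then complex_of_real (h n) else 0)) \<and>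
     (\<forall>f\<in>L2_space \<Omega> w. \<forall>\<epsilon>>0. \<exists>c N. L2_norm \<Omega> w (\<lambda>t. f t - (\<Sum>n<N. c n * \<psi> n t)) < \<epsilon>)"

lemma L2_norm_basis_seq:
  assumes "L2_orthogonal_basis_seq \<Omega> w \<psi> h" "0 \<le> h n"
  shows "(L2_norm \<Omega> w (\<psi> n))\<^sup>2 = h n"
  using assms unfolding L2_orthogonal_basis_seq_def L2_norm_def by simp

lemma L2_orthogonal_basis_range:
  assumes seq: "L2_orthogonal_basis_seq \<Omega> w \<psi> h" and h: "\<And>n. 0 < h n"
  shows "L2_orthogonal_basis \<Omega> w (range \<psi>)"
  unfolding L2_orthogonal_basis_def
proof (intro conjI ballI allI impI)
  show "range \<psi> \<subseteq> L2_space \<Omega> w"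
    using seq unfolding L2_orthogonal_basis_seq_def by auto
  show "L2_norm \<Omega> w g \<noteq> 0" if "g \<in> range \<psi>" for g
  proof -
    from that obtain n where "g = \<psi> n" by auto
    then show ?thesis
      using L2_norm_basis_seq[OF seq, of n] h[of n] by auto
  qed
  show "pairwise (\<lambda>g h. L2_inner \<Omega> w g h = 0) (range \<psi>)"
    using seq unfolding L2_orthogonal_basis_seq_def pairwise_def by auto
  fix f and \<epsilon> :: real assume "f \<in> L2_space \<Omega> w" "\<epsilon> > 0"
  then obtain c N where cN: "L2_norm \<Omega> w (\<lambda>t. f t - (\<Sum>n<N. c n * \<psi> n t)) < \<epsilon>"
    using seq unfolding L2_orthogonal_basis_seq_def by blast
  \<comment> \<open>Indices with the same function share one coefficient, the sum of theirs.\<close>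
  have "(\<Sum>n<N. c n * \<psi> n t) = (\<Sum>g\<in>\<psi> ` {..<N}. (\<Sum>n | n \<in> {..<N} \<and> \<psi> n = g. c n) * g t)" for t
    by (subst sum.image_gen[where g = \<psi>]) (auto simp: sum_distrib_right intro!: sum.cong)
  then show "\<exists>F c. finite F \<and> F \<subseteq> range \<psi> \<and> L2_norm \<Omega> w (\<lambda>t. f t - (\<Sum>g\<in>F. c g * g t)) < \<epsilon>"
    using cN by (intro exI[of _ "\<psi> ` {..<N}"] exI[of _ "\<lambda>g. \<Sum>n | n \<in> {..<N} \<and> \<psi> n = g. c n"]) auto
qed

lemma measurable_uminus_lebesgue: "uminus \<in> lebesgue \<rightarrow>\<^sub>M (lebesgue :: real measure)"
proof -
  have "(*\<^sub>R) (-1) = (uminus :: real \<Rightarrow> real)" by (simp add: fun_eq_iff)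
  then show ?thesis
    using lebesgue_measurable_scaling[where 'a = real, of "-1"] by (simp only:)
qed

lemma uminus_image_eq_vimage: "uminus ` A = uminus -` A" for A :: "real set"
  by (auto simp: image_iff) (metis minus_minus)

lemma uminus_image_lebesgue: "A \<in> sets lebesgue \<Longrightarrow> uminus ` A \<in> sets lebesgue" for A :: "real set"
  using measurable_sets[OF measurable_uminus_lebesgue, of A] by (simp add: uminus_image_eq_vimage)

lemma distr_lebesgue_uminus: "distr lebesgue lebesgue uminus = (lebesgue :: real measure)"
  using lebesgue_real_scale[of "-1"] by (simp add: density_1 one_ennreal_def[symmetric])

lemma distr_lebesgue_on_uminus:
  fixes \<Omega> :: "real set"
  assumes \<Omega>: "\<Omega> \<in> sets lebesgue"
  shows "uminus \<in> lebesgue_on (uminus ` \<Omega>) \<rightarrow>\<^sub>M lebesgue_on \<Omega>"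
    and "distr (lebesgue_on (uminus ` \<Omega>)) (lebesgue_on \<Omega>) uminus = lebesgue_on \<Omega>"
proof -
  show meas: "uminus \<in> lebesgue_on (uminus ` \<Omega>) \<rightarrow>\<^sub>M lebesgue_on \<Omega>"
    by (rule measurable_restrict_space3[OF measurable_uminus_lebesgue]) auto
  show "distr (lebesgue_on (uminus ` \<Omega>)) (lebesgue_on \<Omega>) uminus = lebesgue_on \<Omega>"
  proof (rule measure_eqI)
    fix A assume "A \<in> sets (distr (lebesgue_on (uminus ` \<Omega>)) (lebesgue_on \<Omega>) uminus)"
    then have A: "A \<in> sets (lebesgue_on \<Omega>)" by simp
    then have A': "A \<in> sets lebesgue" "A \<subseteq> \<Omega>"
      using \<Omega> by (auto simp: sets_restrict_space_iff)
    have "emeasure (distr (lebesgue_on (uminus ` \<Omega>)) (lebesgue_on \<Omega>) uminus) A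
        = emeasure (lebesgue_on (uminus ` \<Omega>)) (uminus -` A \<inter> uminus ` \<Omega>)"
      using emeasure_distr[OF meas A] by simp
    also have "uminus -` A \<inter> uminus ` \<Omega> = uminus -` A"
      unfolding uminus_image_eq_vimage using A'(2) by auto
    also have "emeasure (lebesgue_on (uminus ` \<Omega>)) (uminus -` A) = emeasure lebesgue (uminus -` A)"
      using A' uminus_image_lebesgue[OF \<Omega>]
      by (intro emeasure_restrict_space) (auto simp: uminus_image_eq_vimage)
    also have "\<dots> = emeasure (distr lebesgue lebesgue uminus) A"
      using emeasure_distr[OF measurable_uminus_lebesgue A'(1)] by simp
    also have "\<dots> = emeasure (lebesgue_on \<Omega>) A"
      unfolding distr_lebesgue_uminus using A' \<Omega> by (intro emeasure_restrict_space[symmetric]) auto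
    finally show "emeasure (distr (lebesgue_on (uminus ` \<Omega>)) (lebesgue_on \<Omega>) uminus) A = emeasure (lebesgue_on \<Omega>) A" .
  qed simp
qed

lemma L2_space_reflect:
  assumes \<Omega>: "\<Omega> \<in> sets lebesgue" and even: "\<And>t. w (- t) = w t" and f: "f \<in> L2_space \<Omega> w"
  shows "(\<lambda>t. f (- t)) \<in> L2_space (uminus ` \<Omega>) w"
proof -
  note uminus = distr_lebesgue_on_uminus[OF \<Omega>]
  from f have meas: "f \<in> borel_measurable (lebesgue_on \<Omega>)"
    and int: "integrable (lebesgue_on \<Omega>) (\<lambda>t. (cmod (f t))\<^sup>2 * w t)"
    by (auto simp: L2_space_def)
  have "integrable (lebesgue_on (uminus ` \<Omega>)) (\<lambda>t. (cmod (f (- t)))\<^sup>2 * w (- t))"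
    using integrable_distr[OF uminus(1), of "\<lambda>t. (cmod (f t))\<^sup>2 * w t"] int unfolding uminus(2) by simp
  then show ?thesis
    using measurable_compose[OF uminus(1) meas] by (simp add: L2_space_def even)
qed

lemma L2_inner_reflect:
  assumes \<Omega>: "\<Omega> \<in> sets lebesgue" and w: "w \<in> borel_measurable (lebesgue_on \<Omega>)" "\<And>t. w (- t) = w t"
    and f: "f \<in> borel_measurable (lebesgue_on \<Omega>)" and g: "g \<in> borel_measurable (lebesgue_on \<Omega>)"
  shows "L2_inner (uminus ` \<Omega>) w (\<lambda>t. f (- t)) (\<lambda>t. g (- t)) = L2_inner \<Omega> w f g"
proof -
  note [measurable] = w(1) f g
  have [measurable]: "cnj \<in> borel_measurable borel"
    by (intro borel_measurable_continuous_onI continuous_intros)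
  have "(\<lambda>t. cnj (f t) * g t * complex_of_real (w t)) \<in> borel_measurable (lebesgue_on \<Omega>)"
    by measurable
  from integral_distr[OF distr_lebesgue_on_uminus(1)[OF \<Omega>] this]
  show ?thesis
    unfolding distr_lebesgue_on_uminus(2)[OF \<Omega>] L2_inner_def by (simp add: w(2))
qed

text \<open>
  Reflection, followed by multiplication with a number of modulus 1, is a unitary map from the
  space over \<open>\<Omega>\<close> onto the space over \<open>- \<Omega>\<close>, because the weight is even.
\<close>

lemma L2_orthogonal_basis_seq_reflect:
  assumes \<Omega>: "\<Omega> \<in> sets lebesgue"
    and w: "w \<in> borel_measurable (lebesgue_on \<Omega>)" "\<And>t. 0 \<le> w t" "\<And>t. w (- t) = w t"
    and k: "cmod k = 1" and seq: "L2_orthogonal_basis_seq \<Omega> w \<psi> h"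
  shows "L2_orthogonal_basis_seq (uminus ` \<Omega>) w (\<lambda>n t. k * \<psi> n (- t)) h"
  unfolding L2_orthogonal_basis_seq_def
proof (intro conjI ballI allI impI)
  have \<psi>: "\<psi> n \<in> L2_space \<Omega> w" for n
    using seq by (simp add: L2_orthogonal_basis_seq_def)
  have meas: "f \<in> borel_measurable (lebesgue_on \<Omega>)" if "f \<in> L2_space \<Omega> w" for f
    using that by (simp add: L2_space_def)
  have "k \<noteq> 0" using k by auto
  show "(\<lambda>t. k * \<psi> n (- t)) \<in> L2_space (uminus ` \<Omega>) w" for n
    by (intro L2_space_scale L2_space_reflect \<Omega> w \<psi>)
  have "cnj k * k = 1"
    using k complex_norm_square[of k] by (simp add: mult.commute)
  then have scale: "L2_inner A w (\<lambda>t. k * f t) (\<lambda>t. k * g t) = L2_inner A w f g" for A f g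
  proof -
    have "cnj (k * x) * (k * y) = (cnj k * k) * (cnj x * y)" for x y
      by (simp only: complex_cnj_mult mult_ac)
    then show ?thesis
      unfolding L2_inner_def \<open>cnj k * k = 1\<close> by (simp only: mult_1_left)
  qed
  show "L2_inner (uminus ` \<Omega>) w (\<lambda>t. k * \<psi> m (- t)) (\<lambda>t. k * \<psi> n (- t))
      = (if m = n then complex_of_real (h n) else 0)" for m n
    unfolding scale L2_inner_reflect[OF \<Omega> w(1,3) meas[OF \<psi>] meas[OF \<psi>]]
    using seq by (simp add: L2_orthogonal_basis_seq_def)
  fix f and \<epsilon> :: real assume f: "f \<in> L2_space (uminus ` \<Omega>) w" and "\<epsilon> > 0"
  let ?f = "\<lambda>t. f (- t)"
  have "uminus ` \<Omega> \<in> sets lebesgue"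
    by (rule uminus_image_lebesgue[OF \<Omega>])
  then have "?f \<in> L2_space (uminus ` uminus ` \<Omega>) w"
    by (intro L2_space_reflect f w)
  then have f': "?f \<in> L2_space \<Omega> w"
    by (simp add: image_image)
  have "\<forall>f\<in>L2_space \<Omega> w. \<forall>\<epsilon>>0. \<exists>c N. L2_norm \<Omega> w (\<lambda>t. f t - (\<Sum>n<N. c n * \<psi> n t)) < \<epsilon>"
    using seq by (simp add: L2_orthogonal_basis_seq_def)
  from bspec[OF this f'] obtain c N where cN: "L2_norm \<Omega> w (\<lambda>t. ?f t - (\<Sum>n<N. c n * \<psi> n t)) < \<epsilon>"
    using \<open>\<epsilon> > 0\<close> by blast
  let ?r = "\<lambda>t. ?f t - (\<Sum>n<N. c n * \<psi> n t)"
  have r: "?r \<in> borel_measurable (lebesgue_on \<Omega>)"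
    by (intro borel_measurable_diff borel_measurable_sum borel_measurable_times borel_measurable_const meas f' \<psi>)
  have "L2_norm (uminus ` \<Omega>) w (\<lambda>t. ?r (- t)) < \<epsilon>"
    using cN by (simp only: L2_norm_def L2_inner_reflect[OF \<Omega> w(1,3) r r])
  moreover have "?r (- t) = f t - (\<Sum>n<N. c n / k * (k * \<psi> n (- t)))" for t
    using \<open>k \<noteq> 0\<close> by simp
  ultimately show "\<exists>c N. L2_norm (uminus ` \<Omega>) w (\<lambda>t. f t - (\<Sum>n<N. c n * (k * \<psi> n (- t)))) < \<epsilon>"
    by (intro exI[of _ "\<lambda>n. c n / k"] exI[of _ N]) simp
qed

lemma L2_inner_supported:
  assumes "\<Omega> \<in> sets lebesgue" "\<And>t. t \<notin> \<Omega> \<Longrightarrow> g t = 0"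
  shows "L2_inner UNIV w g h = L2_inner \<Omega> w g h"
proof -
  have "L2_inner UNIV w g h = (LINT t|lebesgue. (if t \<in> \<Omega> then cnj (g t) * h t * complex_of_real (w t) else 0))"
    unfolding L2_inner_def lebesgue_on_UNIV_eq
    by (intro arg_cong[of _ _ "integral\<^sup>L _"]) (auto simp: fun_eq_iff assms(2))
  also have "\<dots> = L2_inner \<Omega> w g h"
    unfolding L2_inner_def by (rule Lebesgue_Measure.integral_restrict_UNIV[OF assms(1)])
  finally show ?thesis .
qed

lemma L2_space_supported:
  assumes \<Omega>: "\<Omega> \<in> sets lebesgue" and van: "\<And>t. t \<notin> \<Omega> \<Longrightarrow> g t = 0" and g: "g \<in> L2_space \<Omega> w"
  shows "g \<in> L2_space UNIV w"
proof -
  have eq: "(\<lambda>t. if t \<in> \<Omega> then g t else 0) = g"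
    "(\<lambda>t. if t \<in> \<Omega> then (cmod (g t))\<^sup>2 * w t else 0) = (\<lambda>t. (cmod (g t))\<^sup>2 * w t)"
    using van by auto
  show ?thesis
    using g borel_measurable_if[OF \<Omega>, of g] Lebesgue_Measure.integrable_restrict_UNIV[OF \<Omega>, of "\<lambda>t. (cmod (g t))\<^sup>2 * w t"]
    unfolding L2_space_def eq lebesgue_on_UNIV_eq by simp
qed

lemma L2_space_restrict:
  assumes \<Omega>: "\<Omega> \<in> sets lebesgue" and f: "f \<in> L2_space UNIV w"
  shows "f \<in> L2_space \<Omega> w"
proof -
  have f': "f \<in> borel_measurable lebesgue" "integrable lebesgue (\<lambda>t. (cmod (f t))\<^sup>2 * w t)"
    using f by (auto simp: L2_space_def lebesgue_on_UNIV_eq)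
  have "integrable lebesgue (\<lambda>t. indicator \<Omega> t *\<^sub>R ((cmod (f t))\<^sup>2 * w t))"
    by (rule integrable_mult_indicator[OF \<Omega> f'(2)])
  then have "integrable (lebesgue_on \<Omega>) (\<lambda>t. (cmod (f t))\<^sup>2 * w t)"
    using \<Omega> by (subst integrable_restrict_space) auto
  then show ?thesis
    using f'(1) by (simp add: L2_space_def measurable_restrict_space1)
qed

lemma L2_norm_split:
  assumes \<Omega>: "\<Omega>1 \<in> sets lebesgue" "\<Omega>2 \<in> sets lebesgue" "\<Omega>1 \<inter> \<Omega>2 = {}"
    and w: "\<And>t. t \<notin> \<Omega>1 \<union> \<Omega>2 \<Longrightarrow> w t = 0" "\<And>t. 0 \<le> w t" and r: "r \<in> L2_space UNIV w"
  shows "(L2_norm UNIV w r)\<^sup>2 = (L2_norm \<Omega>1 w r)\<^sup>2 + (L2_norm \<Omega>2 w r)\<^sup>2"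
proof -
  let ?q = "\<lambda>t. (cmod (r t))\<^sup>2 * w t"
  have int: "integrable lebesgue (\<lambda>t. if t \<in> A then ?q t else 0)" if "A \<in> sets lebesgue" for A
    unfolding Lebesgue_Measure.integrable_restrict_UNIV[OF that]
    using L2_space_restrict[OF that r] by (simp add: L2_space_def)
  have "?q t = (if t \<in> \<Omega>1 then ?q t else 0) + (if t \<in> \<Omega>2 then ?q t else 0)" for t
    using \<Omega>(3) w(1) by auto
  then have "(LINT t|lebesgue. ?q t)
      = (LINT t|lebesgue. (if t \<in> \<Omega>1 then ?q t else 0) + (if t \<in> \<Omega>2 then ?q t else 0))"
    by presburger
  also have "\<dots> = (LINT t|lebesgue_on \<Omega>1. ?q t) + (LINT t|lebesgue_on \<Omega>2. ?q t)"
    by (subst Bochner_Integration.integral_add[OF int int]) (simp_all add: Lebesgue_Measure.integral_restrict_UNIV \<Omega>)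
  finally have "(LINT t|lebesgue. ?q t) = (LINT t|lebesgue_on \<Omega>1. ?q t) + (LINT t|lebesgue_on \<Omega>2. ?q t)" .
  moreover have "0 \<le> (LINT t|lebesgue_on A. ?q t)" for A
    by (intro Bochner_Integration.integral_nonneg) (simp add: w(2))
  ultimately show ?thesis
    unfolding L2_norm_eq by (simp add: lebesgue_on_UNIV_eq)
qed

text \<open>
  A function on the line is approximated separately on the two sets. Each basis vanishes where the
  other one lives, so the two approximations do not disturb each other and the squared errors add
  up; the remaining points carry no weight.
\<close>

lemma L2_orthogonal_basis_union:
  assumes \<Omega>: "\<Omega>1 \<in> sets lebesgue" "\<Omega>2 \<in> sets lebesgue" "\<Omega>1 \<inter> \<Omega>2 = {}"
    and w: "w \<in> borel_measurable lebesgue" "\<And>t. 0 \<le> w t" "\<And>t. t \<notin> \<Omega>1 \<union> \<Omega>2 \<Longrightarrow> w t = 0"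
    and B1: "L2_orthogonal_basis \<Omega>1 w B1" "\<And>g t. g \<in> B1 \<Longrightarrow> t \<notin> \<Omega>1 \<Longrightarrow> g t = 0"
    and B2: "L2_orthogonal_basis \<Omega>2 w B2" "\<And>g t. g \<in> B2 \<Longrightarrow> t \<notin> \<Omega>2 \<Longrightarrow> g t = 0"
  shows "L2_orthogonal_basis UNIV w (B1 \<union> B2)"
  unfolding L2_orthogonal_basis_def
proof (intro conjI ballI allI impI)
  have w': "w \<in> borel_measurable (lebesgue_on UNIV)"
    using w(1) by (simp add: lebesgue_on_UNIV_eq)
  have inner1: "L2_inner UNIV w g h = L2_inner \<Omega>1 w g h" if "g \<in> B1" for g h
    by (rule L2_inner_supported[OF \<Omega>(1) B1(2)[OF that]])
  have inner2: "L2_inner UNIV w g h = L2_inner \<Omega>2 w g h" if "g \<in> B2" for g h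
    by (rule L2_inner_supported[OF \<Omega>(2) B2(2)[OF that]])
  have "g \<in> L2_space UNIV w" if "g \<in> B1" for g
    using L2_space_supported[OF \<Omega>(1) B1(2)[OF that]] B1(1) that by (auto simp: L2_orthogonal_basis_def)
  moreover have "g \<in> L2_space UNIV w" if "g \<in> B2" for g
    using L2_space_supported[OF \<Omega>(2) B2(2)[OF that]] B2(1) that by (auto simp: L2_orthogonal_basis_def)
  ultimately show sub: "B1 \<union> B2 \<subseteq> L2_space UNIV w" by blast
  show "L2_norm UNIV w g \<noteq> 0" if "g \<in> B1 \<union> B2" for g
    using that inner1 inner2 B1(1) B2(1) by (auto simp: L2_orthogonal_basis_def L2_norm_def)
  show "pairwise (\<lambda>g h. L2_inner UNIV w g h = 0) (B1 \<union> B2)"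
    unfolding pairwise_def
  proof (intro ballI impI)
    fix g h assume gh: "g \<in> B1 \<union> B2" "h \<in> B1 \<union> B2" "g \<noteq> h"
    have disjoint: "L2_inner UNIV w u v = 0" if "\<And>t. u t = 0 \<or> v t = 0" for u v
    proof -
      have "(\<lambda>t. cnj (u t) * v t * complex_of_real (w t)) = (\<lambda>t. 0)"
        using that by (auto simp: fun_eq_iff)
      then show ?thesis by (simp add: L2_inner_def)
    qed
    consider "g \<in> B1" "h \<in> B1" | "g \<in> B2" "h \<in> B2" | "g \<in> B1" "h \<in> B2" | "g \<in> B2" "h \<in> B1"
      using gh by blast
    then show "L2_inner UNIV w g h = 0"
    proof cases
      case 1
      then show ?thesis using inner1 B1(1) gh by (auto simp: L2_orthogonal_basis_def pairwise_def)
    next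
      case 2
      then show ?thesis using inner2 B2(1) gh by (auto simp: L2_orthogonal_basis_def pairwise_def)
    next
      case 3
      then show ?thesis using B1(2) B2(2) \<Omega>(3) by (intro disjoint) blast
    next
      case 4
      then show ?thesis using B1(2) B2(2) \<Omega>(3) by (intro disjoint) blast
    qed
  qed
  fix f and \<epsilon> :: real assume f: "f \<in> L2_space UNIV w" and "\<epsilon> > 0"
  then have pos: "\<epsilon> / 2 > 0" by simp
  obtain F1 c1 where F1: "finite F1" "F1 \<subseteq> B1" "L2_norm \<Omega>1 w (\<lambda>t. f t - (\<Sum>g\<in>F1. c1 g * g t)) < \<epsilon> / 2"
    using B1(1) L2_space_restrict[OF \<Omega>(1) f] pos unfolding L2_orthogonal_basis_def by blast
  obtain F2 c2 where F2: "finite F2" "F2 \<subseteq> B2" "L2_norm \<Omega>2 w (\<lambda>t. f t - (\<Sum>g\<in>F2. c2 g * g t)) < \<epsilon> / 2"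
    using B2(1) L2_space_restrict[OF \<Omega>(2) f] pos unfolding L2_orthogonal_basis_def by blast
  \<comment> \<open>A sum of two padded families gives the right coefficient also if \<open>F1\<close> and \<open>F2\<close> overlap.\<close>
  define c where "c g = (if g \<in> F1 then c1 g else 0) + (if g \<in> F2 then c2 g else 0)" for g
  let ?r = "\<lambda>t. f t - (\<Sum>g\<in>F1 \<union> F2. c g * g t)"
  have split: "(\<Sum>g\<in>F1 \<union> F2. c g * g t) = (\<Sum>g\<in>F1. c1 g * g t) + (\<Sum>g\<in>F2. c2 g * g t)" for t
    unfolding c_def distrib_right sum.distrib by (simp add: sum_pad F1(1) F2(1))
  have "L2_norm \<Omega>1 w ?r = L2_norm \<Omega>1 w (\<lambda>t. f t - (\<Sum>g\<in>F1. c1 g * g t))"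
  proof -
    have "(\<Sum>g\<in>F2. c2 g * g t) = 0" if "t \<in> \<Omega>1" for t
      using that \<Omega>(3) B2(2) F2(2) by (intro sum.neutral) auto
    then show ?thesis
      unfolding L2_norm_eq split by (intro arg_cong[of _ _ sqrt] Bochner_Integration.integral_cong) auto
  qed
  moreover have "L2_norm \<Omega>2 w ?r = L2_norm \<Omega>2 w (\<lambda>t. f t - (\<Sum>g\<in>F2. c2 g * g t))"
  proof -
    have "(\<Sum>g\<in>F1. c1 g * g t) = 0" if "t \<in> \<Omega>2" for t
      using that \<Omega>(3) B1(2) F1(2) by (intro sum.neutral) auto
    then show ?thesis
      unfolding L2_norm_eq split by (intro arg_cong[of _ _ sqrt] Bochner_Integration.integral_cong) auto
  qed
  moreover have norm_nonneg: "0 \<le> L2_norm A w u" for A u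
    unfolding L2_norm_eq by (simp add: Bochner_Integration.integral_nonneg w(2))
  moreover have "?r \<in> L2_space UNIV w"
    using sub F1(2) F2(2) by (intro L2_space_diff[OF w' w(2) f] L2_space_sum[OF w' w(2)]) auto
  then have "(L2_norm UNIV w ?r)\<^sup>2 = (L2_norm \<Omega>1 w ?r)\<^sup>2 + (L2_norm \<Omega>2 w ?r)\<^sup>2"
    using w(2,3) by (intro L2_norm_split[OF \<Omega>]) auto
  ultimately have "(L2_norm UNIV w ?r)\<^sup>2 < (\<epsilon> / 2)\<^sup>2 + (\<epsilon> / 2)\<^sup>2"
    using F1(3) F2(3) by (simp only:) (intro add_strict_mono power_strict_mono, auto)
  also have "\<dots> \<le> \<epsilon>\<^sup>2"
    by (simp add: power_divide)
  finally have "L2_norm UNIV w ?r < \<epsilon>"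
    using \<open>\<epsilon> > 0\<close> by (simp add: power_less_imp_less_base)
  then show "\<exists>F c. finite F \<and> F \<subseteq> B1 \<union> B2 \<and> L2_norm UNIV w (\<lambda>t. f t - (\<Sum>g\<in>F. c g * g t)) < \<epsilon>"
    using F1 F2 by (intro exI[of _ "F1 \<union> F2"] exI[of _ c]) auto
qed

section \<open>The functions on the half-lines and on the line\<close>

definition psi_factor :: "nat \<Rightarrow> nat \<Rightarrow> real" where
  "psi_factor \<nu> m = fact \<nu> / sqrt (fact (2 * \<nu>)) * (fact m / fact (m + \<nu> + 1))"

definition psi_envelope :: "nat \<Rightarrow> real \<Rightarrow> real" where
  "psi_envelope \<nu> t = (2 * t) ^ (\<nu> + 1) * exp (- t)"

lemma psi_plus_pos:
  "0 < t \<Longrightarrow> psi_plus \<nu> m t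
    = complex_of_real (psi_factor \<nu> m * (psi_envelope \<nu> t * laguerre m (real (\<nu> + 1)) (2 * t)))"
  by (simp add: psi_plus_def psi_factor_def psi_envelope_def)

lemma psi_plus_nonpos: "t \<le> 0 \<Longrightarrow> psi_plus \<nu> m t = 0"
  by (cases "t = 0") (auto simp: psi_plus_def)

lemma psi_envelope_pos: "0 < t \<Longrightarrow> 0 < psi_envelope \<nu> t"
  by (simp add: psi_envelope_def)

lemma psi_envelope_weight:
  assumes "0 < t"
  shows "(psi_envelope \<nu> t)\<^sup>2 * weight \<nu> t = 2 * (2 * t) ^ (\<nu> + 1) * exp (- 2 * t)"
proof -
  have "(exp (- t))\<^sup>2 = exp (- 2 * t)"
    by (simp add: power2_eq_square exp_add[symmetric])
  moreover have "(x * e)\<^sup>2 * (2 / x) = 2 * x * e\<^sup>2" if "x \<noteq> 0" for x e :: real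
    using that by (simp add: power2_eq_square)
  from this[of "(2 * t) ^ (\<nu> + 1)" "exp (- t)"]
  have "(psi_envelope \<nu> t)\<^sup>2 * weight \<nu> t = 2 * (2 * t) ^ (\<nu> + 1) * (exp (- t))\<^sup>2"
    using assms unfolding psi_envelope_def weight_def by simp
  ultimately show ?thesis by simp
qed

lemma weight_nonneg: "0 \<le> weight \<nu> t"
  by (simp add: weight_def)

lemma weight_even: "weight \<nu> (- t) = weight \<nu> t"
  by (simp add: weight_def)

lemma borel_measurable_weight: "weight \<nu> \<in> borel_measurable borel"
  unfolding weight_def by measurable

text \<open>
  Multiplication by the envelope is an isometry from the space of the Laguerre measure onto the
  weighted space on the positive half-line; this is its integral form.
\<close>

lemma lebesgue_on_pos_eq_laguerre_measure:
  fixes u :: "real \<Rightarrow> real"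
  assumes u: "u \<in> borel_measurable (lebesgue_on {0<..})"
  shows "integrable (lebesgue_on {0<..}) (\<lambda>t. (psi_envelope \<nu> t)\<^sup>2 * u t * weight \<nu> t)
      \<longleftrightarrow> integrable (laguerre_measure (\<nu> + 1)) u"
    and "(LINT t|lebesgue_on {0<..}. (psi_envelope \<nu> t)\<^sup>2 * u t * weight \<nu> t)
      = (LINT t|laguerre_measure (\<nu> + 1). u t)"
proof -
  let ?d = "\<lambda>t. 2 * (2 * t) ^ (\<nu> + 1) * exp (- 2 * t) :: real"
  have d: "?d \<in> borel_measurable (lebesgue_on {0<..})" "AE t in lebesgue_on {0<..}. 0 \<le> ?d t"
    by (auto intro!: measurable_lebesgue_on_borel AE_I2)
  have eq: "?d t *\<^sub>R u t = (psi_envelope \<nu> t)\<^sup>2 * u t * weight \<nu> t" if "t \<in> space (lebesgue_on {0<..})" for t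
    using psi_envelope_weight[of t \<nu>] that by (simp add: mult_ac)
  show "integrable (lebesgue_on {0<..}) (\<lambda>t. (psi_envelope \<nu> t)\<^sup>2 * u t * weight \<nu> t)
      \<longleftrightarrow> integrable (laguerre_measure (\<nu> + 1)) u"
    unfolding laguerre_measure_def integrable_density[OF u d]
    by (intro Bochner_Integration.integrable_cong refl) (rule eq[symmetric])
  show "(LINT t|lebesgue_on {0<..}. (psi_envelope \<nu> t)\<^sup>2 * u t * weight \<nu> t)
      = (LINT t|laguerre_measure (\<nu> + 1). u t)"
    unfolding laguerre_measure_def integral_density[OF u d]
    by (intro Bochner_Integration.integral_cong refl) (rule eq[symmetric])
qed

text \<open>
  Used with the real and the imaginary part in the place of \<open>p\<close>: approximation by Laguerre
  polynomials takes place in a real space, separately for both parts.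
\<close>

lemma square_integrable_quotient_envelope:
  assumes f: "f \<in> L2_space {0<..} (weight \<nu>)"
    and p: "p \<in> borel_measurable borel" "\<And>z. \<bar>p z\<bar> \<le> cmod z"
  shows "square_integrable (laguerre_measure (\<nu> + 1)) (\<lambda>t. p (f t) / psi_envelope \<nu> t)"
proof -
  have f': "f \<in> borel_measurable (lebesgue_on {0<..})"
    "integrable (lebesgue_on {0<..}) (\<lambda>t. (cmod (f t))\<^sup>2 * weight \<nu> t)"
    using f by (auto simp: L2_space_def)
  have w: "weight \<nu> \<in> borel_measurable (lebesgue_on {0<..})"
    by (intro measurable_lebesgue_on_borel borel_measurable_weight)
  have env: "psi_envelope \<nu> \<in> borel_measurable (lebesgue_on {0<..})"
    unfolding psi_envelope_def by (intro measurable_lebesgue_on_borel) measurable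
  have pf: "(\<lambda>t. p (f t)) \<in> borel_measurable (lebesgue_on {0<..})"
    by (rule measurable_compose[OF f'(1) p(1)])
  have meas: "(\<lambda>t. p (f t) / psi_envelope \<nu> t) \<in> borel_measurable (lebesgue_on {0<..})"
    by (intro borel_measurable_divide pf env)
  have "integrable (lebesgue_on {0<..}) (\<lambda>t. (p (f t))\<^sup>2 * weight \<nu> t)"
  proof (rule Bochner_Integration.integrable_bound[OF f'(2)])
    show "(\<lambda>t. (p (f t))\<^sup>2 * weight \<nu> t) \<in> borel_measurable (lebesgue_on {0<..})"
      by (intro borel_measurable_times borel_measurable_power pf w)
    have "(p z)\<^sup>2 \<le> (cmod z)\<^sup>2" for z
      using power_mono[OF p(2)[of z], of 2] by simp
    then show "AE t in lebesgue_on {0<..}. norm ((p (f t))\<^sup>2 * weight \<nu> t) \<le> norm ((cmod (f t))\<^sup>2 * weight \<nu> t)"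
      by (intro AE_I2) (simp add: abs_mult mult_right_mono)
  qed
  also have "?this \<longleftrightarrow> integrable (lebesgue_on {0<..})
      (\<lambda>t. (psi_envelope \<nu> t)\<^sup>2 * (p (f t) / psi_envelope \<nu> t)\<^sup>2 * weight \<nu> t)"
  proof (intro Bochner_Integration.integrable_cong refl)
    fix t :: real assume "t \<in> space (lebesgue_on {0<..})"
    then have "psi_envelope \<nu> t \<noteq> 0"
      using psi_envelope_pos[of t \<nu>] by simp
    then show "(p (f t))\<^sup>2 * weight \<nu> t
        = (psi_envelope \<nu> t)\<^sup>2 * (p (f t) / psi_envelope \<nu> t)\<^sup>2 * weight \<nu> t"
      by (simp add: power_divide)
  qed
  finally show ?thesis
    using meas lebesgue_on_pos_eq_laguerre_measure(1)[OF borel_measurable_power[OF meas, of 2], of \<nu>]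
    by (simp add: square_integrable_def measurable_laguerre_measure)
qed

text \<open>
  Everything is pulled back along the envelope isometry. For completeness, the real and imaginary
  parts of \<open>f / b\<close> are approximated by Laguerre polynomials, the two coefficient families are
  combined to complex coefficients, and the squared errors add up.
\<close>

lemma L2_orthogonal_basis_seq_psi_plus:
  "L2_orthogonal_basis_seq {0<..} (weight \<nu>) (psi_plus \<nu>)
     (\<lambda>m. (fact \<nu>)\<^sup>2 / fact (2 * \<nu>) * (fact m / fact (m + \<nu> + 1)))"
  unfolding L2_orthogonal_basis_seq_def
proof (intro conjI allI ballI impI)
  let ?W = "weight \<nu>" and ?b = "psi_envelope \<nu>" and ?K = "psi_factor \<nu>"
    and ?L = "\<lambda>n t. laguerre n (real (\<nu> + 1)) (2 * t)" and ?\<mu> = "laguerre_measure (\<nu> + 1)"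
  have L: "square_integrable ?\<mu> (?L n)" for n
    by (rule square_integrable_laguerre)
  have L_meas: "?L n \<in> borel_measurable (lebesgue_on {0<..})" for n
    using L by (simp only: square_integrable_def measurable_laguerre_measure)
  have K: "?K n \<noteq> 0" for n
    by (simp add: psi_factor_def)
  show "psi_plus \<nu> n \<in> L2_space {0<..} ?W" for n
  proof -
    have "psi_plus \<nu> n \<in> borel_measurable (lebesgue_on {0<..})"
      unfolding psi_plus_def laguerre_def by (intro measurable_lebesgue_on_borel) measurable
    moreover have "integrable (lebesgue_on {0<..}) (\<lambda>t. (?K n)\<^sup>2 * ((?b t)\<^sup>2 * (?L n t)\<^sup>2 * ?W t))"
      using L[of n] lebesgue_on_pos_eq_laguerre_measure(1)[OF borel_measurable_power[OF L_meas, of n 2], of \<nu>]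
      by (simp add: square_integrable_def)
    then have "integrable (lebesgue_on {0<..}) (\<lambda>t. (cmod (psi_plus \<nu> n t))\<^sup>2 * ?W t)"
      by (rule Bochner_Integration.integrable_cong[THEN iffD1, OF refl, rotated])
         (simp add: psi_plus_pos norm_mult power_mult_distrib mult_ac)
    ultimately show ?thesis by (simp add: L2_space_def)
  qed
  show "L2_inner {0<..} ?W (psi_plus \<nu> m) (psi_plus \<nu> n)
      = (if m = n then complex_of_real ((fact \<nu>)\<^sup>2 / fact (2 * \<nu>) * (fact n / fact (n + \<nu> + 1))) else 0)" for m n
  proof -
    have "L2_inner {0<..} ?W (psi_plus \<nu> m) (psi_plus \<nu> n)
        = (LINT t|lebesgue_on {0<..}. complex_of_real (?K m * ?K n * ((?b t)\<^sup>2 * (?L m t * ?L n t) * ?W t)))"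
      unfolding L2_inner_def
      by (intro Bochner_Integration.integral_cong refl) (simp add: psi_plus_pos power2_eq_square mult_ac)
    also have "\<dots> = complex_of_real (?K m * ?K n * (LINT t|?\<mu>. ?L m t * ?L n t))"
      unfolding integral_complex_of_real integral_mult_right_zero
        lebesgue_on_pos_eq_laguerre_measure(2)[OF borel_measurable_times[OF L_meas L_meas]] ..
    also have "(LINT t|?\<mu>. ?L m t * ?L n t) = (if m = n then fact (n + (\<nu> + 1)) / fact n else 0)"
      by (rule has_bochner_integral_integral_eq[OF has_bochner_integral_laguerre_laguerre])
    also have "?K m * ?K n * (if m = n then fact (n + (\<nu> + 1)) / fact n else 0)
        = (if m = n then (fact \<nu>)\<^sup>2 / fact (2 * \<nu>) * (fact n / fact (n + \<nu> + 1)) else 0)"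
    proof -
      have "(x / s * (y / z)) * (x / s * (y / z)) * (z / y) = x\<^sup>2 / s\<^sup>2 * (y / z)"
        if "z \<noteq> 0" "y \<noteq> 0" for x s y z :: real
        using that by (simp add: power2_eq_square)
      from this[of "fact (n + \<nu> + 1)" "fact n" "fact \<nu>" "sqrt (fact (2 * \<nu>))"]
      show ?thesis by (simp add: psi_factor_def add.assoc del: fact_Suc)
    qed
    finally show ?thesis by simp
  qed
  fix f and \<epsilon> :: real assume f: "f \<in> L2_space {0<..} ?W" and "\<epsilon> > 0"
  define u where "u t = Re (f t) / ?b t" for t
  define v where "v t = Im (f t) / ?b t" for t
  have uv: "square_integrable ?\<mu> u" "square_integrable ?\<mu> v"
    unfolding u_def v_def
    by (rule square_integrable_quotient_envelope[OF f], measurable, simp add: abs_Re_le_cmod abs_Im_le_cmod)+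
  have pos: "\<epsilon>\<^sup>2 / 2 > 0" using \<open>\<epsilon> > 0\<close> by simp
  obtain d N where dN: "(LINT t|?\<mu>. (u t - (\<Sum>n<N. d n * ?L n t))\<^sup>2) < \<epsilon>\<^sup>2 / 2"
    using L2_approximable_laguerre[OF uv(1)] pos unfolding L2_approximable_def by blast
  obtain e J where eJ: "(LINT t|?\<mu>. (v t - (\<Sum>n<J. e n * ?L n t))\<^sup>2) < \<epsilon>\<^sup>2 / 2"
    using L2_approximable_laguerre[OF uv(2)] pos unfolding L2_approximable_def by blast
  let ?U = "\<lambda>t. u t - (\<Sum>n<N. d n * ?L n t)" and ?V = "\<lambda>t. v t - (\<Sum>n<J. e n * ?L n t)"
  define d' where "d' n = (if n < N then d n else 0)" for n
  define e' where "e' n = (if n < J then e n else 0)" for n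
  define c where "c n = Complex (d' n) (e' n) / complex_of_real (?K n)" for n
  let ?r = "\<lambda>t. f t - (\<Sum>n<max N J. c n * psi_plus \<nu> n t)"
  have r: "?r t = complex_of_real (?b t) * Complex (?U t) (?V t)" if "0 < t" for t
  proof -
    have "c n * psi_plus \<nu> n t = complex_of_real (?b t) * Complex (d' n * ?L n t) (e' n * ?L n t)" for n
      using K[of n] by (simp add: c_def psi_plus_pos[OF that] complex_eq_iff)
    then have "(\<Sum>n<max N J. c n * psi_plus \<nu> n t)
        = complex_of_real (?b t) * (\<Sum>n<max N J. Complex (d' n * ?L n t) (e' n * ?L n t))"
      by (simp add: sum_distrib_left)
    also have "(\<Sum>n<max N J. Complex (d' n * ?L n t) (e' n * ?L n t))
        = Complex (\<Sum>n<N. d n * ?L n t) (\<Sum>n<J. e n * ?L n t)"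
      unfolding complex_eq_iff Re_sum Im_sum d'_def e'_def by (simp add: sum_lessThan_pad)
    finally show ?thesis
      using psi_envelope_pos[OF that, of \<nu>]
      by (simp add: complex_eq_iff u_def v_def right_diff_distrib)
  qed
  have UV: "square_integrable ?\<mu> ?U" "square_integrable ?\<mu> ?V"
    by (intro square_integrable_diff square_integrable_sum square_integrable_scale uv L)+
  then have UV_meas: "(\<lambda>t. (?U t)\<^sup>2 + (?V t)\<^sup>2) \<in> borel_measurable (lebesgue_on {0<..})"
    unfolding square_integrable_def measurable_laguerre_measure
    by (intro borel_measurable_add borel_measurable_power) blast+
  have "(LINT t|lebesgue_on {0<..}. (cmod (?r t))\<^sup>2 * ?W t)
      = (LINT t|lebesgue_on {0<..}. (?b t)\<^sup>2 * ((?U t)\<^sup>2 + (?V t)\<^sup>2) * ?W t)"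
  proof (intro Bochner_Integration.integral_cong refl)
    fix t :: real assume "t \<in> space (lebesgue_on {0<..})"
    then have "0 < t" by simp
    show "(cmod (?r t))\<^sup>2 * ?W t = (?b t)\<^sup>2 * ((?U t)\<^sup>2 + (?V t)\<^sup>2) * ?W t"
      unfolding r[OF \<open>0 < t\<close>] norm_mult power_mult_distrib by (simp add: cmod_def)
  qed
  also have "\<dots> = (LINT t|?\<mu>. (?U t)\<^sup>2 + (?V t)\<^sup>2)"
    by (rule lebesgue_on_pos_eq_laguerre_measure(2)[OF UV_meas])
  also have "\<dots> = (LINT t|?\<mu>. (?U t)\<^sup>2) + (LINT t|?\<mu>. (?V t)\<^sup>2)"
    using UV unfolding square_integrable_def by (intro Bochner_Integration.integral_add) blast+
  also have "\<dots> < \<epsilon>\<^sup>2"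
    using dN eJ by simp
  finally have "L2_norm {0<..} ?W ?r < \<epsilon>"
    unfolding L2_norm_eq using \<open>\<epsilon> > 0\<close> by (intro real_less_lsqrt) auto
  then show "\<exists>c N. L2_norm {0<..} ?W (\<lambda>t. f t - (\<Sum>n<N. c n * psi_plus \<nu> n t)) < \<epsilon>"
    by blast
qed

theorem proposition3p2:
  fixes \<nu> :: nat
  shows "L2_orthogonal_basis UNIV (weight \<nu>) (M_full \<nu>) \<and>
         L2_orthogonal_basis {0<..} (weight \<nu>) (M_plus \<nu>) \<and>
         L2_orthogonal_basis {..<0} (weight \<nu>) (M_minus \<nu>) \<and>
         (\<forall>m::nat.
           (L2_norm UNIV (weight \<nu>) (psi_plus \<nu> m))\<^sup>2
             = (fact \<nu>)\<^sup>2 / fact (2 * \<nu>) * (fact m / fact (m + \<nu> + 1)) \<and>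
           (L2_norm UNIV (weight \<nu>) (psi_minus \<nu> m))\<^sup>2
             = (fact \<nu>)\<^sup>2 / fact (2 * \<nu>) * (fact m / fact (m + \<nu> + 1)))"
proof -
  let ?w = "weight \<nu>" and ?h = "\<lambda>m. (fact \<nu>)\<^sup>2 / fact (2 * \<nu>) * (fact m / fact (m + \<nu> + 1)) :: real"
  have h: "0 < ?h m" for m by simp
  have pos: "L2_orthogonal_basis_seq {0<..} ?w (psi_plus \<nu>) ?h"
    by (rule L2_orthogonal_basis_seq_psi_plus)
  have "L2_orthogonal_basis_seq (uminus ` {0<..}) ?w (\<lambda>n t. (-1) ^ \<nu> * psi_plus \<nu> n (- t)) ?h"
    by (rule L2_orthogonal_basis_seq_reflect[OF _ _ weight_nonneg weight_even _ pos])
       (auto intro: measurable_lebesgue_on_borel borel_measurable_weight simp: norm_power)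
  moreover have "uminus ` {0<..} = {..<0::real}"
    by simp
  moreover have "(\<lambda>n t. (-1) ^ \<nu> * psi_plus \<nu> n (- t)) = psi_minus \<nu>"
    by (simp add: psi_minus_def fun_eq_iff)
  ultimately have neg: "L2_orthogonal_basis_seq {..<0} ?w (psi_minus \<nu>) ?h"
    by simp
  have psi_minus_nonneg: "psi_minus \<nu> m t = 0" if "0 \<le> t" for m t
    using that by (simp add: psi_minus_def psi_plus_nonpos)
  have plus: "L2_orthogonal_basis {0<..} ?w (M_plus \<nu>)"
    unfolding M_plus_def by (rule L2_orthogonal_basis_range[OF pos h])
  have minus: "L2_orthogonal_basis {..<0} ?w (M_minus \<nu>)"
    unfolding M_minus_def by (rule L2_orthogonal_basis_range[OF neg h])
  have w_meas: "?w \<in> borel_measurable lebesgue"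
    by (rule measurable_completion) (simp add: borel_measurable_weight)
  have full: "L2_orthogonal_basis UNIV ?w (M_full \<nu>)"
    unfolding M_full_def
  proof (rule L2_orthogonal_basis_union[OF _ _ _ w_meas weight_nonneg _ minus _ plus])
    show "?w t = 0" if "t \<notin> {..<0} \<union> {0<..}" for t
    proof -
      have "t = 0" using that by auto
      then show ?thesis by (simp add: weight_def)
    qed
    show "g t = 0" if "g \<in> M_minus \<nu>" "t \<notin> {..<0}" for g t
      using that psi_minus_nonneg by (auto simp: M_minus_def)
    show "g t = 0" if "g \<in> M_plus \<nu>" "t \<notin> {0<..}" for g t
      using that psi_plus_nonpos by (auto simp: M_plus_def)
  qed auto
  have "(L2_norm UNIV ?w (psi_plus \<nu> m))\<^sup>2 = ?h m" for m
    using L2_norm_basis_seq[OF pos less_imp_le[OF h], of m]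
      L2_inner_supported[of "{0<..}" "psi_plus \<nu> m"] psi_plus_nonpos
    by (simp add: L2_norm_def)
  moreover have "(L2_norm UNIV ?w (psi_minus \<nu> m))\<^sup>2 = ?h m" for m
    using L2_norm_basis_seq[OF neg less_imp_le[OF h], of m]
      L2_inner_supported[of "{..<0}" "psi_minus \<nu> m"] psi_minus_nonneg
    by (simp add: L2_norm_def)
  ultimately show ?thesis
    using full plus minus by blast
qed

end
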